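(* Let $t\in\mathbb{R}\setminus\{0\}$ and $(c_1,c_2)\in\mathbb{Q}^2\setminus\{(0,0)\}$, and let $H^7$ be the simply-connected nilpotent Lie group with a basis $e^1,\dots,e^7$ of left-invariant 1-forms satisfying $$de^1=\dots=de^5=0,\quad de^6=-2t(e^{12}-e^{34}),\quad de^7=c_1(e^{13}+e^{24})+c_2(e^{14}-e^{23}).$$ Let $M^7=\Gamma\backslash H^7$ be a compact nilmanifold ($\Gamma$ a lattice of maximal rank) with the $G_2$-structure $$\Theta=(e^{12}+e^{34}+e^{56})\wedge e^7+e^{135}-e^{146}-e^{236}-e^{245},$$ and let $T=-*d\Theta$, $\nabla^+=\nabla^g+\frac12T$. For $\lambda\in\mathbb{R}$ let $A_\lambda$ be the metric linear connection on $M^7$ with connection forms $$(\sigma^{A_\lambda})^i_j=\lambda e^7\ \ (1\le i<j\le5),\qquad (\sigma^{A_\lambda})^6_7=e^1+e^2+e^3+e^4+e^5+\lambda e^6+\lambda e^7,$$ all other $(\sigma^{A_\lambda})^i_j$ with $i<j$ being zero. If $\lambda^2<\min\{8t^2,\,2(c_1^2+c_2^2)/11\}$, then $$dT=2\pi^2\alpha'\big(p_1(\nabla^+)-p_1(A_\lambda)\big)$$ with some constant $\alpha'>0$, and $(M^7,\Theta,\nabla^+,A_\lambda)$ is a compact solution to the heterotic Killing spinor equations (with constant dilaton and flux $H=T$) satisfying the anomaly cancellation condition.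
   Context: $e^{ij\dots}=e^i\wedge e^j\wedge\cdots$. The metric is $g=\sum_i e^i\otimes e^i$, the orientation is $e^{1\cdots7}$, and $\nabla^g$ is the Levi-Civita connection; $g(\nabla^+_XY,Z)=g(\nabla^g_XY,Z)+\frac12T(X,Y,Z)$. With $\{E_i\}$ the dual frame, the connection forms of $\nabla$ are defined by $\nabla_XE_j=\sigma^i_j(X)E_i$, with $\sigma^j_i=-\sigma^i_j$ for metric connections; curvature $\Omega^i_j=d\sigma^i_j+\sigma^i_k\wedge\sigma^k_j$; $p_1(\nabla)=\frac1{8\pi^2}\sum_{i<j}\Omega^i_j\wedge\Omega^i_j$. The heterotic Killing spinor equations (existence of a nonzero real spinor $\epsilon$, the one defining $\Theta$, with $\nabla^+\epsilon=0$, $(d\phi-\frac12H)\cdot\epsilon=0$, $F^A\cdot\epsilon=0$) with constant dilaton $\phi$ amount, in dimension 7, to: $d*\Theta=0$ and $d\Theta\wedge\Theta=0$ (cocalibrated of pure type), $H=T=-*d\Theta$, and $A$ is a $G_2$-instanton, i.e. all its curvature 2-forms $\beta$ satisfy $\beta\wedge*\Theta=0$. The anomaly cancellation condition is $dT=2\pi^2\alpha'(p_1(\nabla^+)-p_1(A))$ with $\alpha'>0$. *)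

theory Defs
  imports
    "HOL-Analysis.Analysis"
    "HOL-Library.Function_Algebras"
    "HOL-Algebra.Coset"
    "HOL-Algebra.Generated_Groups"
begin

text \<open>
  A simply connected nilpotent Lie group of dimension 7 is diffeomorphic to Euclidean 7-space via
  its exponential map, so the underlying manifold of such a group is taken to be \<^typ>\<open>real ^ 7\<close>,
  with an arbitrary smooth group law.  Geometric objects on a quotient by a lattice are the
  lattice-invariant objects on the group.
\<close>

type_synonym R7 = "real ^ 7"
type_synonym spinor = "real ^ 8"

subsection \<open>Smooth maps\<close>

text \<open>On finite-dimensional spaces, a map is of class $C^{n+1}$ iff it is differentiable and all its
  directional derivatives are of class $C^n$.\<close>

primrec C_k :: "nat \<Rightarrow> ('a::euclidean_space \<Rightarrow> 'b::real_normed_vector) \<Rightarrow> bool" where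
  "C_k 0 f \<longleftrightarrow> continuous_on UNIV f"
| "C_k (Suc n) f \<longleftrightarrow>
     (\<forall>x. f differentiable (at x)) \<and> (\<forall>v. C_k n (\<lambda>x. frechet_derivative f (at x) v))"

definition smooth :: "('a::euclidean_space \<Rightarrow> 'b::real_normed_vector) \<Rightarrow> bool" where
  "smooth f \<longleftrightarrow> (\<forall>n. C_k n f)"

subsection \<open>Differential forms\<close>

text \<open>A form assigns to a point and a list of tangent vectors a real number.  A form of degree $k$
  vanishes on all lists of length other than $k$.  Sums, differences, negation and zero are
  pointwise (\<^theory>\<open>HOL-Library.Function_Algebras\<close>).\<close>

type_synonym form = "R7 \<Rightarrow> R7 list \<Rightarrow> real"

definition scale_form :: "real \<Rightarrow> form \<Rightarrow> form" (infixr "*\<^sub>F" 75) where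
  "c *\<^sub>F \<omega> = (\<lambda>x vs. c * \<omega> x vs)"

definition fun_form :: "(R7 \<Rightarrow> real) \<Rightarrow> form" where
  "fun_form f = (\<lambda>x vs. if vs = [] then f x else 0)"

text \<open>The sign of the shuffle that sorts the concatenation of (the increasing enumerations of)
  two disjoint finite sets of natural numbers.\<close>

definition shuffle_sign :: "nat set \<Rightarrow> nat set \<Rightarrow> real" where
  "shuffle_sign I J = (-1) ^ card {(i, j). i \<in> I \<and> j \<in> J \<and> j < i}"

text \<open>Sum over shuffles without factorial prefactors, so that
  $(\alpha\wedge\beta)(u,v)=\alpha(u)\beta(v)-\alpha(v)\beta(u)$ for 1-forms.\<close>

definition wedge :: "form \<Rightarrow> form \<Rightarrow> form" (infixr "\<and>\<^sub>F" 70) where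
  "(\<alpha> \<and>\<^sub>F \<beta>) = (\<lambda>x vs. \<Sum>I \<in> Pow {..<length vs}.
      shuffle_sign I ({..<length vs} - I)
        * \<alpha> x (nths vs I) * \<beta> x (nths vs ({..<length vs} - I)))"

text \<open>$(d\omega)(v_0,\dots,v_k)=\sum_i(-1)^i\,D_{v_i}\omega(v_0,\dots,\widehat{v_i},\dots,v_k)$
  for constant vector fields $v_j$.\<close>

definition ext_d :: "form \<Rightarrow> form" where
  "ext_d \<omega> = (\<lambda>x vs. \<Sum>i<length vs.
      (-1) ^ i * frechet_derivative (\<lambda>y. \<omega> y (take i vs @ drop (Suc i) vs)) (at x) (vs ! i))"

definition pullback :: "(R7 \<Rightarrow> R7) \<Rightarrow> form \<Rightarrow> form" where
  "pullback f \<omega> = (\<lambda>x vs. \<omega> (f x) (map (frechet_derivative f (at x)) vs))"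

definition one_form :: "form \<Rightarrow> bool" where
  "one_form \<omega> \<longleftrightarrow>
     (\<forall>x. linear (\<lambda>v. \<omega> x [v])) \<and> (\<forall>v. smooth (\<lambda>x. \<omega> x [v])) \<and>
     (\<forall>x vs. length vs \<noteq> 1 \<longrightarrow> \<omega> x vs = 0)"

text \<open>For a coframe, \<open>monomial e [i, j, \<dots>]\<close> is $e^{ij\dots}=e^i\wedge e^j\wedge\cdots$.\<close>

definition monomial :: "(nat \<Rightarrow> form) \<Rightarrow> nat list \<Rightarrow> form" where
  "monomial e is = foldr (\<lambda>i \<omega>. e i \<and>\<^sub>F \<omega>) is (fun_form (\<lambda>_. 1))"

subsection \<open>Lie groups, lattices and nilmanifolds\<close>

definition lie_group :: "R7 monoid \<Rightarrow> bool" where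
  "lie_group G \<longleftrightarrow> group G \<and> carrier G = UNIV \<and>
     smooth (\<lambda>(x, y). x \<otimes>\<^bsub>G\<^esub> y) \<and> smooth (\<lambda>x. inv\<^bsub>G\<^esub> x)"

primrec lower_central_series :: "('a, 'b) monoid_scheme \<Rightarrow> nat \<Rightarrow> 'a set" where
  "lower_central_series G 0 = carrier G"
| "lower_central_series G (Suc n) = generate G
     {x \<otimes>\<^bsub>G\<^esub> y \<otimes>\<^bsub>G\<^esub> inv\<^bsub>G\<^esub> x \<otimes>\<^bsub>G\<^esub> inv\<^bsub>G\<^esub> y | x y. x \<in> lower_central_series G n \<and> y \<in> carrier G}"

definition nilpotent :: "('a, 'b) monoid_scheme \<Rightarrow> bool" where
  "nilpotent G \<longleftrightarrow> (\<exists>n. lower_central_series G n = {\<one>\<^bsub>G\<^esub>})"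

text \<open>The quotient topology on $\Gamma\backslash G$.\<close>

definition nilmanifold :: "R7 monoid \<Rightarrow> R7 set \<Rightarrow> R7 set topology" where
  "nilmanifold G \<Gamma> =
     topology (\<lambda>U. U \<subseteq> rcosets\<^bsub>G\<^esub> \<Gamma> \<and> open {x \<in> carrier G. \<Gamma> #>\<^bsub>G\<^esub> x \<in> U})"

lemma openin_nilmanifold:
  "openin (nilmanifold G \<Gamma>) U \<longleftrightarrow>
     U \<subseteq> rcosets\<^bsub>G\<^esub> \<Gamma> \<and> open {x \<in> carrier G. \<Gamma> #>\<^bsub>G\<^esub> x \<in> U}"
proof -
  let ?L = "\<lambda>U. U \<subseteq> rcosets\<^bsub>G\<^esub> \<Gamma> \<and> open {x \<in> carrier G. \<Gamma> #>\<^bsub>G\<^esub> x \<in> U}"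
  have "istopology ?L"
    unfolding istopology_def
  proof (intro conjI allI impI)
    fix S T assume "?L S" "?L T"
    moreover have "{x \<in> carrier G. \<Gamma> #>\<^bsub>G\<^esub> x \<in> S \<inter> T} =
        {x \<in> carrier G. \<Gamma> #>\<^bsub>G\<^esub> x \<in> S} \<inter> {x \<in> carrier G. \<Gamma> #>\<^bsub>G\<^esub> x \<in> T}" by auto
    ultimately show "S \<inter> T \<subseteq> rcosets\<^bsub>G\<^esub> \<Gamma>" "open {x \<in> carrier G. \<Gamma> #>\<^bsub>G\<^esub> x \<in> S \<inter> T}"
      by auto
  next
    fix K assume K: "\<forall>S\<in>K. ?L S"
    have "{x \<in> carrier G. \<Gamma> #>\<^bsub>G\<^esub> x \<in> \<Union> K} = (\<Union>S\<in>K. {x \<in> carrier G. \<Gamma> #>\<^bsub>G\<^esub> x \<in> S})"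
      by auto
    with K show "\<Union> K \<subseteq> rcosets\<^bsub>G\<^esub> \<Gamma>" "open {x \<in> carrier G. \<Gamma> #>\<^bsub>G\<^esub> x \<in> \<Union> K}"
      by (auto intro!: open_UN)
  qed
  then show ?thesis
    unfolding nilmanifold_def by simp
qed

text \<open>In a nilpotent Lie group, the discrete subgroups of maximal rank are exactly the discrete
  cocompact ones.\<close>

definition lattice_of_max_rank :: "R7 monoid \<Rightarrow> R7 set \<Rightarrow> bool" where
  "lattice_of_max_rank G \<Gamma> \<longleftrightarrow>
     subgroup \<Gamma> G \<and> discrete \<Gamma> \<and> compact_space (nilmanifold G \<Gamma>)"

definition invariant_form :: "R7 monoid \<Rightarrow> R7 set \<Rightarrow> form \<Rightarrow> bool" where
  "invariant_form G S \<omega> \<longleftrightarrow> (\<forall>a\<in>S. pullback (\<lambda>x. a \<otimes>\<^bsub>G\<^esub> x) \<omega> = \<omega>)"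

definition left_invariant_one_form :: "R7 monoid \<Rightarrow> form \<Rightarrow> bool" where
  "left_invariant_one_form G \<omega> \<longleftrightarrow> one_form \<omega> \<and> invariant_form G (carrier G) \<omega>"

definition left_invariant_basis :: "R7 monoid \<Rightarrow> (nat \<Rightarrow> form) \<Rightarrow> bool" where
  "left_invariant_basis G e \<longleftrightarrow>
     (\<forall>i\<in>{1..7}. left_invariant_one_form G (e i)) \<and>
     (\<forall>\<omega>. left_invariant_one_form G \<omega> \<longrightarrow>
        (\<exists>!c. c \<in> extensional {1..7} \<and> \<omega> = (\<Sum>i=1..7. c i *\<^sub>F e i)))"

subsection \<open>Metric, orientation and Hodge star determined by a coframe\<close>

definition dual_frame :: "(nat \<Rightarrow> form) \<Rightarrow> (nat \<Rightarrow> R7 \<Rightarrow> R7) \<Rightarrow> bool" where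
  "dual_frame e E \<longleftrightarrow> (\<forall>j\<in>{1..7}. smooth (E j)) \<and>
     (\<forall>i\<in>{1..7}. \<forall>j\<in>{1..7}. \<forall>x. e i x [E j x] = (if i = j then 1 else 0))"

definition metric :: "(nat \<Rightarrow> form) \<Rightarrow> R7 \<Rightarrow> R7 \<Rightarrow> R7 \<Rightarrow> real" where
  "metric e x u v = (\<Sum>i=1..7. e i x [u] * e i x [v])"

text \<open>The coefficient of $e^{i_1\dots i_k}$, $I = \{i_1<\dots<i_k\}$, in a form.\<close>

definition frame_coeff :: "(nat \<Rightarrow> R7 \<Rightarrow> R7) \<Rightarrow> form \<Rightarrow> nat set \<Rightarrow> R7 \<Rightarrow> real" where
  "frame_coeff E \<omega> I x = \<omega> x (map (\<lambda>i. E i x) (sorted_list_of_set I))"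

text \<open>The linear extension of $*e^I=\pm e^{\{1..7\}-I}$, the sign being such that
  $e^I\wedge *e^I=e^{1\cdots7}$.\<close>

definition hodge :: "(nat \<Rightarrow> form) \<Rightarrow> (nat \<Rightarrow> R7 \<Rightarrow> R7) \<Rightarrow> form \<Rightarrow> form" where
  "hodge e E \<omega> = (\<lambda>x vs. \<Sum>I \<in> Pow {1..7}.
      frame_coeff E \<omega> I x * shuffle_sign I ({1..7} - I)
        * monomial e (sorted_list_of_set ({1..7} - I)) x vs)"

subsection \<open>Linear connections on the quotient\<close>

definition functions_on :: "R7 monoid \<Rightarrow> R7 set \<Rightarrow> (R7 \<Rightarrow> real) set" where
  "functions_on G \<Gamma> = {f. smooth f \<and> (\<forall>\<gamma>\<in>\<Gamma>. \<forall>x. f (\<gamma> \<otimes>\<^bsub>G\<^esub> x) = f x)}"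

definition vfields_on :: "R7 monoid \<Rightarrow> R7 set \<Rightarrow> (R7 \<Rightarrow> R7) set" where
  "vfields_on G \<Gamma> = {X. smooth X \<and>
     (\<forall>\<gamma>\<in>\<Gamma>. \<forall>x. X (\<gamma> \<otimes>\<^bsub>G\<^esub> x) = frechet_derivative (\<lambda>y. \<gamma> \<otimes>\<^bsub>G\<^esub> y) (at x) (X x))}"

definition dir_deriv :: "(R7 \<Rightarrow> R7) \<Rightarrow> (R7 \<Rightarrow> 'b::real_normed_vector) \<Rightarrow> R7 \<Rightarrow> 'b" where
  "dir_deriv X f x = frechet_derivative f (at x) (X x)"

definition lie_bracket :: "(R7 \<Rightarrow> R7) \<Rightarrow> (R7 \<Rightarrow> R7) \<Rightarrow> R7 \<Rightarrow> R7" where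
  "lie_bracket X Y x = dir_deriv X Y x - dir_deriv Y X x"

type_synonym connection = "(R7 \<Rightarrow> R7) \<Rightarrow> (R7 \<Rightarrow> R7) \<Rightarrow> R7 \<Rightarrow> R7"

definition linear_connection :: "R7 monoid \<Rightarrow> R7 set \<Rightarrow> connection \<Rightarrow> bool" where
  "linear_connection G \<Gamma> nabla \<longleftrightarrow>
     (\<forall>X\<in>vfields_on G \<Gamma>. \<forall>Y\<in>vfields_on G \<Gamma>. \<forall>Z\<in>vfields_on G \<Gamma>. \<forall>f\<in>functions_on G \<Gamma>.
        nabla X Y \<in> vfields_on G \<Gamma> \<and>
        nabla (\<lambda>x. X x + Y x) Z = (\<lambda>x. nabla X Z x + nabla Y Z x) \<and>
        nabla (\<lambda>x. f x *\<^sub>R X x) Y = (\<lambda>x. f x *\<^sub>R nabla X Y x) \<and>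
        nabla X (\<lambda>x. Y x + Z x) = (\<lambda>x. nabla X Y x + nabla X Z x) \<and>
        nabla X (\<lambda>x. f x *\<^sub>R Y x) = (\<lambda>x. dir_deriv X f x *\<^sub>R Y x + f x *\<^sub>R nabla X Y x))"

definition metric_connection ::
  "R7 monoid \<Rightarrow> R7 set \<Rightarrow> (nat \<Rightarrow> form) \<Rightarrow> connection \<Rightarrow> bool" where
  "metric_connection G \<Gamma> e nabla \<longleftrightarrow> linear_connection G \<Gamma> nabla \<and>
     (\<forall>X\<in>vfields_on G \<Gamma>. \<forall>Y\<in>vfields_on G \<Gamma>. \<forall>Z\<in>vfields_on G \<Gamma>. \<forall>x.
        dir_deriv X (\<lambda>y. metric e y (Y y) (Z y)) x =
          metric e x (nabla X Y x) (Z x) + metric e x (Y x) (nabla X Z x))"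

definition levi_civita ::
  "R7 monoid \<Rightarrow> R7 set \<Rightarrow> (nat \<Rightarrow> form) \<Rightarrow> connection \<Rightarrow> bool" where
  "levi_civita G \<Gamma> e nabla \<longleftrightarrow> metric_connection G \<Gamma> e nabla \<and>
     (\<forall>X\<in>vfields_on G \<Gamma>. \<forall>Y\<in>vfields_on G \<Gamma>. \<forall>x.
        nabla X Y x - nabla Y X x = lie_bracket X Y x)"

text \<open>\<open>nabla'\<close> is the connection $\nabla+\frac12T$.\<close>

definition torsion_shift ::
  "R7 monoid \<Rightarrow> R7 set \<Rightarrow> (nat \<Rightarrow> form) \<Rightarrow> connection \<Rightarrow> form \<Rightarrow> connection \<Rightarrow> bool" where
  "torsion_shift G \<Gamma> e nabla T nabla' \<longleftrightarrow>
     (\<forall>X\<in>vfields_on G \<Gamma>. \<forall>Y\<in>vfields_on G \<Gamma>. \<forall>Z\<in>vfields_on G \<Gamma>. \<forall>x.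
        metric e x (nabla' X Y x) (Z x) =
          metric e x (nabla X Y x) (Z x) + 1/2 * T x [X x, Y x, Z x])"

text \<open>The 1-form $\sigma^i_j$ with $\nabla_XE_j=\sigma^i_j(X)E_i$, written with
  $X=\sum_k e^k(X)E_k$ because only the (left-invariant) fields $E_k$, not arbitrary tangent
  vectors, are arguments of a connection.\<close>

definition conn_form ::
  "(nat \<Rightarrow> form) \<Rightarrow> (nat \<Rightarrow> R7 \<Rightarrow> R7) \<Rightarrow> connection \<Rightarrow> nat \<Rightarrow> nat \<Rightarrow> form" where
  "conn_form e E nabla i j =
     (\<Sum>k=1..7. (\<lambda>x vs. e i x [nabla (E k) (E j) x] * e k x vs))"

definition curvature ::
  "(nat \<Rightarrow> form) \<Rightarrow> (nat \<Rightarrow> R7 \<Rightarrow> R7) \<Rightarrow> connection \<Rightarrow> nat \<Rightarrow> nat \<Rightarrow> form" where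
  "curvature e E nabla i j = ext_d (conn_form e E nabla i j) +
     (\<Sum>k=1..7. conn_form e E nabla i k \<and>\<^sub>F conn_form e E nabla k j)"

definition p1 :: "(nat \<Rightarrow> form) \<Rightarrow> (nat \<Rightarrow> R7 \<Rightarrow> R7) \<Rightarrow> connection \<Rightarrow> form" where
  "p1 e E nabla = (1 / (8 * pi\<^sup>2)) *\<^sub>F
     (\<Sum>j=1..7. \<Sum>i=1..<j. curvature e E nabla i j \<and>\<^sub>F curvature e E nabla i j)"

subsection \<open>Spinors\<close>

text \<open>A real spin representation in dimension 7: \<open>cl i\<close> is Clifford multiplication by $E_i$.  Of the
  two inequivalent irreducible modules (interchanged by \<open>cl \<mapsto> -cl\<close>), the one on which
  $E_1\cdots E_7$ acts as the identity is used.\<close>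

definition clifford_module :: "(nat \<Rightarrow> spinor \<Rightarrow> spinor) \<Rightarrow> bool" where
  "clifford_module cl \<longleftrightarrow>
     (\<forall>i\<in>{1..7}. linear (cl i) \<and> (\<forall>\<psi> \<eta>. cl i \<psi> \<bullet> \<eta> = - (\<psi> \<bullet> cl i \<eta>))) \<and>
     (\<forall>i\<in>{1..7}. \<forall>j\<in>{1..7}. \<forall>\<psi>.
        cl i (cl j \<psi>) + cl j (cl i \<psi>) = (if i = j then - 2 else 0) *\<^sub>R \<psi>) \<and>
     (\<forall>\<psi>. foldr cl [1..<8] \<psi> = \<psi>)"

text \<open>The spinor bundle is trivialised by the global orthonormal frame \<open>E\<close>.\<close>

definition spinor_fields_on :: "R7 monoid \<Rightarrow> R7 set \<Rightarrow> (R7 \<Rightarrow> spinor) set" where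
  "spinor_fields_on G \<Gamma> = {\<epsilon>. smooth \<epsilon> \<and> (\<forall>\<gamma>\<in>\<Gamma>. \<forall>x. \<epsilon> (\<gamma> \<otimes>\<^bsub>G\<^esub> x) = \<epsilon> x)}"

definition clifford_action ::
  "(nat \<Rightarrow> R7 \<Rightarrow> R7) \<Rightarrow> (nat \<Rightarrow> spinor \<Rightarrow> spinor) \<Rightarrow> form \<Rightarrow> (R7 \<Rightarrow> spinor) \<Rightarrow> R7 \<Rightarrow> spinor" where
  "clifford_action E cl \<omega> \<epsilon> x =
     (\<Sum>I \<in> Pow {1..7}. frame_coeff E \<omega> I x *\<^sub>R foldr cl (sorted_list_of_set I) (\<epsilon> x))"

text \<open>The spin connection
  $\nabla_v\epsilon=D_v\epsilon+\frac12\sum_{j<k}g(\nabla_vE_j,E_k)\,E_j\cdot E_k\cdot\epsilon$,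
  for which Clifford multiplication is parallel when $E_i\cdot E_i=-1$.\<close>

definition spin_connection ::
  "(nat \<Rightarrow> form) \<Rightarrow> (nat \<Rightarrow> R7 \<Rightarrow> R7) \<Rightarrow> (nat \<Rightarrow> spinor \<Rightarrow> spinor) \<Rightarrow> connection \<Rightarrow>
   (R7 \<Rightarrow> spinor) \<Rightarrow> R7 \<Rightarrow> R7 \<Rightarrow> spinor" where
  "spin_connection e E cl nabla \<epsilon> x v = frechet_derivative \<epsilon> (at x) v +
     (1/2) *\<^sub>R (\<Sum>k=1..7. \<Sum>j=1..<k. conn_form e E nabla k j x [v] *\<^sub>R cl j (cl k (\<epsilon> x)))"

text \<open>The 3-form of a spinor, $\Theta(X,Y,Z)=-\langle X\cdot Y\cdot Z\cdot\epsilon,\epsilon\rangle$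
  for unit $\epsilon$.  With the choice of module above, this sign is the one for which the 3-form is
  compatible with the orientation $e^{1\cdots7}$.\<close>

definition spinor_defines ::
  "(nat \<Rightarrow> R7 \<Rightarrow> R7) \<Rightarrow> (nat \<Rightarrow> spinor \<Rightarrow> spinor) \<Rightarrow> (R7 \<Rightarrow> spinor) \<Rightarrow> form \<Rightarrow> bool" where
  "spinor_defines E cl \<epsilon> \<Theta> \<longleftrightarrow>
     (\<forall>x. \<forall>i\<in>{1..7}. \<forall>j\<in>{1..7}. \<forall>k\<in>{1..7}.
        (\<epsilon> x \<bullet> \<epsilon> x) * \<Theta> x [E i x, E j x, E k x] = - (cl i (cl j (cl k (\<epsilon> x))) \<bullet> \<epsilon> x))"

definition heterotic_killing_spinor_eqs ::
  "R7 monoid \<Rightarrow> R7 set \<Rightarrow> (nat \<Rightarrow> form) \<Rightarrow> (nat \<Rightarrow> R7 \<Rightarrow> R7) \<Rightarrow> (nat \<Rightarrow> spinor \<Rightarrow> spinor) \<Rightarrow>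
   form \<Rightarrow> connection \<Rightarrow> connection \<Rightarrow> (R7 \<Rightarrow> real) \<Rightarrow> form \<Rightarrow> bool" where
  "heterotic_killing_spinor_eqs G \<Gamma> e E cl \<Theta> nabla_plus nabla_A \<phi> H \<longleftrightarrow>
     (\<exists>\<epsilon> \<in> spinor_fields_on G \<Gamma>.
        (\<forall>x. \<epsilon> x \<noteq> 0) \<and> spinor_defines E cl \<epsilon> \<Theta> \<and>
        (\<forall>x v. spin_connection e E cl nabla_plus \<epsilon> x v = 0) \<and>
        (\<forall>x. clifford_action E cl (ext_d (fun_form \<phi>) - (1/2) *\<^sub>F H) \<epsilon> x = 0) \<and>
        (\<forall>i\<in>{1..7}. \<forall>j\<in>{1..7}. \<forall>x. clifford_action E cl (curvature e E nabla_A i j) \<epsilon> x = 0))"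

subsection \<open>G2-structures\<close>

definition cocalibrated_pure_type ::
  "(nat \<Rightarrow> form) \<Rightarrow> (nat \<Rightarrow> R7 \<Rightarrow> R7) \<Rightarrow> form \<Rightarrow> bool" where
  "cocalibrated_pure_type e E \<Theta> \<longleftrightarrow>
     ext_d (hodge e E \<Theta>) = 0 \<and> ext_d \<Theta> \<and>\<^sub>F \<Theta> = 0"

definition G2_instanton ::
  "(nat \<Rightarrow> form) \<Rightarrow> (nat \<Rightarrow> R7 \<Rightarrow> R7) \<Rightarrow> form \<Rightarrow> connection \<Rightarrow> bool" where
  "G2_instanton e E \<Theta> nabla \<longleftrightarrow>
     (\<forall>i\<in>{1..7}. \<forall>j\<in>{1..7}. curvature e E nabla i j \<and>\<^sub>F hodge e E \<Theta> = 0)"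

definition anomaly_cancellation ::
  "(nat \<Rightarrow> form) \<Rightarrow> (nat \<Rightarrow> R7 \<Rightarrow> R7) \<Rightarrow> form \<Rightarrow> connection \<Rightarrow> connection \<Rightarrow> real \<Rightarrow> bool" where
  "anomaly_cancellation e E H nabla_plus nabla_A \<alpha>' \<longleftrightarrow>
     \<alpha>' > 0 \<and> ext_d H = (2 * pi\<^sup>2 * \<alpha>') *\<^sub>F (p1 e E nabla_plus - p1 e E nabla_A)"

text \<open>The heterotic system on $\Gamma\backslash G$ with dilaton \<open>\<phi>\<close>, which is assumed constant, and
  flux \<open>H\<close>: the Killing spinor equations, both in spinorial form and in their 7-dimensional
  \<open>G\<^sub>2\<close> form, together with the anomaly cancellation condition.\<close>

definition compact_heterotic_solution ::
  "R7 monoid \<Rightarrow> R7 set \<Rightarrow> (nat \<Rightarrow> form) \<Rightarrow> (nat \<Rightarrow> R7 \<Rightarrow> R7) \<Rightarrow> (nat \<Rightarrow> spinor \<Rightarrow> spinor) \<Rightarrow>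
   form \<Rightarrow> connection \<Rightarrow> connection \<Rightarrow> real \<Rightarrow> form \<Rightarrow> real \<Rightarrow> bool" where
  "compact_heterotic_solution G \<Gamma> e E cl \<Theta> nabla_plus nabla_A \<phi> H \<alpha>' \<longleftrightarrow>
     compact_space (nilmanifold G \<Gamma>) \<and>
     heterotic_killing_spinor_eqs G \<Gamma> e E cl \<Theta> nabla_plus nabla_A (\<lambda>_. \<phi>) H \<and>
     cocalibrated_pure_type e E \<Theta> \<and> H = - hodge e E (ext_d \<Theta>) \<and> G2_instanton e E \<Theta> nabla_A \<and>
     anomaly_cancellation e E H nabla_plus nabla_A \<alpha>'"

end

theory Submission
  imports Defs
begin

text \<open>
  The torsion is $T=\sum_m e^m\wedge de^m$, and for such a torsion Koszul's formula collapses: the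
  connection forms of $\nabla^+$ are $\sigma^i_j=\sum_k de^k(E_j,E_i)\,e^k$.  Hence $\nabla^+$ takes its
  values in the span of $de^6$ and $de^7$, regarded as skew endomorphisms, and the curvature of
  $A_\lambda$ consists of multiples of $de^6$ and $de^7$ as well.  Both 2-forms are annihilated by
  $\wedge *\Theta$ and kill the spinor defining $\Theta$.  That spinor is a joint eigenvector of
  commuting involutions in the Clifford algebra; it is constant in the frame, so it is parallel.
  All 4-forms in the anomaly condition are multiples of $e^{1234}$: with $c^2=c_1^2+c_2^2$,
  $dT=-(8t^2+2c^2)e^{1234}$, and
  $8\pi^2(p_1(\nabla^+)-p_1(A_\lambda))=-(8t^2(8t^2-\lambda^2)+2c^2(2c^2-11\lambda^2))e^{1234}$.
\<close>

subsection \<open>The exterior algebra\<close>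

text \<open>On the 4-plane spanned by e^1,...,e^4 with orientation e^{1234}, de^6 and de^7 are
  anti-self-dual, while Theta and *Theta meet this plane, apart from the terms e^{567} and e^{1234},
  only through the self-dual forms e^{12}+e^{34}, e^{13}-e^{24}, e^{14}+e^{23}. Self-dual wedge
  anti-self-dual is zero; this is the common reason for d*Theta = 0, for the vanishing of dTheta
  wedge Theta and for the instanton condition. The anti-self-dual forms are a copy of su(2) in g_2,
  hence they annihilate the spinor. For such forms a wedge b = -<a,b> e^{1234}, whence the minus
  signs in the anomaly condition. Shuffle sums are replaced by a recursion on the first argument:
  contraction for \<open>wedge\<close>, Cartan's formula for \<open>ext_d\<close>. Identities of
  concrete forms then reduce to sorting monomials.\<close>

definition iota :: "R7 \<Rightarrow> form \<Rightarrow> form" where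
  "iota v \<omega> = (\<lambda>x vs. \<omega> x (v # vs))"

text \<open>A \<open>form\<close> carries no degree and may be inhomogeneous; reading the degree off
  the number of arguments gives a sign with which both Leibniz rules hold for all forms.\<close>

definition grade_inv :: "form \<Rightarrow> form" where
  "grade_inv \<omega> = (\<lambda>x vs. (-1) ^ length vs * \<omega> x vs)"

lemma nths_Cons_Suc: "nths (v # vs) (Suc ` I) = nths vs I"
  by (simp add: nths_Cons inj_image_mem_iff)

lemma nths_Cons_insert_Suc: "nths (v # vs) (insert 0 (Suc ` I)) = v # nths vs I"
  by (simp add: nths_Cons inj_image_mem_iff)

lemma Suc_image_diff: "{..<Suc n} - Suc ` I = insert 0 (Suc ` ({..<n} - I))"
  by (auto simp: lessThan_Suc_eq_insert_0)

lemma Suc_image_diff_insert: "{..<Suc n} - insert 0 (Suc ` I) = Suc ` ({..<n} - I)"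
  by (auto simp: lessThan_Suc_eq_insert_0)

lemma shuffle_sign_Suc: "shuffle_sign (Suc ` I) (Suc ` J) = shuffle_sign I J"
proof -
  have "{(i, j). i \<in> Suc ` I \<and> j \<in> Suc ` J \<and> j < i} =
      map_prod Suc Suc ` {(i, j). i \<in> I \<and> j \<in> J \<and> j < i}"
    by (auto simp: image_iff)
  moreover have "inj_on (map_prod Suc Suc) A" for A
    by (auto simp: inj_on_def)
  ultimately show ?thesis
    by (simp add: shuffle_sign_def card_image)
qed

lemma shuffle_sign_insert_left: "shuffle_sign (insert 0 I) J = shuffle_sign I J"
proof -
  have "{(i, j). i \<in> insert 0 I \<and> j \<in> J \<and> j < i} = {(i, j). i \<in> I \<and> j \<in> J \<and> j < i}"
    by auto
  then show ?thesis by (simp add: shuffle_sign_def)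
qed

lemma shuffle_sign_insert_right:
  assumes "finite I" "finite J" "0 \<notin> I" "0 \<notin> J"
  shows "shuffle_sign I (insert 0 J) = (-1) ^ card I * shuffle_sign I J"
proof -
  have eq: "{(i, j). i \<in> I \<and> j \<in> insert 0 J \<and> j < i} =
      {(i, j). i \<in> I \<and> j \<in> J \<and> j < i} \<union> I \<times> {0}"
    using assms(3) by (auto intro: gr0I)
  have fin: "finite {(i, j). i \<in> I \<and> j \<in> J \<and> j < i}"
    by (rule finite_subset[of _ "I \<times> J"]) (use assms in auto)
  have "card {(i, j). i \<in> I \<and> j \<in> insert 0 J \<and> j < i} =
      card {(i, j). i \<in> I \<and> j \<in> J \<and> j < i} + card I"
    unfolding eq by (subst card_Un_disjoint) (use assms fin in \<open>auto simp: card_cartesian_product\<close>)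
  then show ?thesis
    by (simp add: shuffle_sign_def power_add)
qed

lemma wedge_Nil [simp]: "(\<alpha> \<and>\<^sub>F \<beta>) x [] = \<alpha> x [] * \<beta> x []"
  by (simp add: wedge_def shuffle_sign_def)

lemma length_nths_le: "I \<subseteq> {..<length vs} \<Longrightarrow> length (nths vs I) = card I"
  by (auto simp: length_nths intro!: arg_cong[of _ _ card])

text \<open>A shuffle gives the first argument either to the left factor or to the right one; in the
  second case it passes all arguments of the left factor, which costs the sign in
  \<open>grade_inv\<close>. This recursion drives the later inductions on the argument list.\<close>

lemma wedge_Cons:
  "(\<alpha> \<and>\<^sub>F \<beta>) x (v # vs) =
     (iota v \<alpha> \<and>\<^sub>F \<beta>) x vs + (grade_inv \<alpha> \<and>\<^sub>F iota v \<beta>) x vs"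
proof -
  let ?n = "length vs"
  let ?t = "\<lambda>I. shuffle_sign I ({..<Suc ?n} - I)
        * \<alpha> x (nths (v # vs) I) * \<beta> x (nths (v # vs) ({..<Suc ?n} - I))"
  have inj: "inj_on (image Suc) S" "inj_on (\<lambda>I. insert 0 (Suc ` I)) S" for S :: "nat set set"
  proof -
    show "inj_on (image Suc) S" by (simp add: inj_on_def inj_image_eq_iff)
    show "inj_on (\<lambda>I. insert 0 (Suc ` I)) S"
    proof (rule inj_onI)
      fix I J :: "nat set" assume "insert 0 (Suc ` I) = insert 0 (Suc ` J)"
      then have "Suc ` I = Suc ` J" by (metis Diff_insert_absorb image_iff nat.distinct(1))
      then show "I = J" by (simp add: inj_image_eq_iff)
    qed
  qed
  \<comment> \<open>Index sets without 0 hand the first argument to \<open>\<beta>\<close>, those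
    with 0 hand it to \<open>\<alpha>\<close>.\<close>
  have pow: "Pow {..<Suc ?n} = image Suc ` Pow {..<?n} \<union> (\<lambda>I. insert 0 (Suc ` I)) ` Pow {..<?n}"
    (is "_ = ?A \<union> ?B")
    unfolding lessThan_Suc_eq_insert_0 Pow_insert image_Pow_surj[OF refl]
    by (auto simp: image_image image_Pow_surj[OF refl, symmetric])
  have "(\<alpha> \<and>\<^sub>F \<beta>) x (v # vs) = sum ?t (Pow {..<Suc ?n})"
    by (simp add: wedge_def)
  also have "\<dots> = sum ?t ?A + sum ?t ?B"
    unfolding pow by (rule sum.union_disjoint) auto
  also have "sum ?t ?B = (iota v \<alpha> \<and>\<^sub>F \<beta>) x vs"
    by (subst sum.reindex[OF inj(2)])
       (simp add: wedge_def iota_def Suc_image_diff_insert nths_Cons_Suc nths_Cons_insert_Suc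
         shuffle_sign_Suc shuffle_sign_insert_left)
  also have "sum ?t ?A = (grade_inv \<alpha> \<and>\<^sub>F iota v \<beta>) x vs"
    unfolding wedge_def
    by (subst sum.reindex[OF inj(1)], rule sum.cong[OF refl])
       (auto simp: grade_inv_def iota_def Suc_image_diff nths_Cons_Suc nths_Cons_insert_Suc
         shuffle_sign_Suc shuffle_sign_insert_right length_nths_le finite_subset card_image)
  finally show ?thesis by simp
qed

section \<open>Bilinearity of the wedge product, signs and associativity\<close>

lemma scale_form_apply: "(c *\<^sub>F \<omega>) x vs = c * \<omega> x vs"
  by (simp add: scale_form_def)

lemma wedge_add_left: "(\<alpha> + \<beta>) \<and>\<^sub>F \<gamma> = (\<alpha> \<and>\<^sub>F \<gamma>) + (\<beta> \<and>\<^sub>F \<gamma>)"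
  by (auto simp: wedge_def fun_eq_iff algebra_simps sum.distrib)

lemma wedge_add_right: "\<alpha> \<and>\<^sub>F (\<beta> + \<gamma>) = (\<alpha> \<and>\<^sub>F \<beta>) + (\<alpha> \<and>\<^sub>F \<gamma>)"
  by (auto simp: wedge_def fun_eq_iff algebra_simps sum.distrib)

lemma wedge_scale_left: "(c *\<^sub>F \<alpha>) \<and>\<^sub>F \<beta> = c *\<^sub>F (\<alpha> \<and>\<^sub>F \<beta>)"
  by (auto simp: wedge_def fun_eq_iff scale_form_def sum_distrib_left ac_simps)

lemma wedge_scale_right: "\<alpha> \<and>\<^sub>F (c *\<^sub>F \<beta>) = c *\<^sub>F (\<alpha> \<and>\<^sub>F \<beta>)"
  by (auto simp: wedge_def fun_eq_iff scale_form_def sum_distrib_left ac_simps)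

lemma uminus_form: "- \<omega> = (-1) *\<^sub>F (\<omega> :: form)"
  by (auto simp: fun_eq_iff scale_form_def)

lemma wedge_minus_left: "(- \<alpha>) \<and>\<^sub>F \<beta> = - (\<alpha> \<and>\<^sub>F \<beta>)"
  by (simp add: uminus_form wedge_scale_left)

lemma wedge_minus_right: "\<alpha> \<and>\<^sub>F (- \<beta>) = - (\<alpha> \<and>\<^sub>F \<beta>)"
  by (simp add: uminus_form wedge_scale_right)

lemma wedge_diff_left: "(\<alpha> - \<beta>) \<and>\<^sub>F \<gamma> = (\<alpha> \<and>\<^sub>F \<gamma>) - (\<beta> \<and>\<^sub>F \<gamma>)"
  by (auto simp: wedge_def fun_eq_iff algebra_simps sum_subtractf)

lemma wedge_diff_right: "\<alpha> \<and>\<^sub>F (\<beta> - \<gamma>) = (\<alpha> \<and>\<^sub>F \<beta>) - (\<alpha> \<and>\<^sub>F \<gamma>)"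
  by (auto simp: wedge_def fun_eq_iff algebra_simps sum_subtractf)

lemma wedge_zero_left [simp]: "0 \<and>\<^sub>F \<beta> = 0"
  by (auto simp: wedge_def fun_eq_iff)

lemma wedge_zero_right [simp]: "\<alpha> \<and>\<^sub>F 0 = 0"
  by (auto simp: wedge_def fun_eq_iff)

lemma grade_inv_grade_inv [simp]: "grade_inv (grade_inv \<omega>) = \<omega>"
  by (auto simp: grade_inv_def fun_eq_iff simp flip: power_add mult.assoc)

lemma iota_grade_inv: "iota v (grade_inv \<omega>) = - grade_inv (iota v \<omega>)"
  by (auto simp: grade_inv_def iota_def fun_eq_iff)

lemma iota_wedge: "iota v (\<alpha> \<and>\<^sub>F \<beta>) = (iota v \<alpha> \<and>\<^sub>F \<beta>) + (grade_inv \<alpha> \<and>\<^sub>F iota v \<beta>)"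
  using wedge_Cons by (auto simp: iota_def fun_eq_iff)

text \<open>The two blocks of a shuffle have lengths adding up to the total, so the sign factors in
  each summand.\<close>

lemma grade_inv_wedge: "grade_inv (\<alpha> \<and>\<^sub>F \<beta>) = grade_inv \<alpha> \<and>\<^sub>F grade_inv \<beta>"
proof -
  have "grade_inv (\<alpha> \<and>\<^sub>F \<beta>) x vs = (grade_inv \<alpha> \<and>\<^sub>F grade_inv \<beta>) x vs" for x vs
  proof -
    let ?n = "length vs"
    have "(-1) ^ ?n * (shuffle_sign I ({..<?n} - I) * \<alpha> x (nths vs I) * \<beta> x (nths vs ({..<?n} - I)))
        = shuffle_sign I ({..<?n} - I) * grade_inv \<alpha> x (nths vs I)
            * grade_inv \<beta> x (nths vs ({..<?n} - I))"
      if "I \<subseteq> {..<?n}" for I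
    proof -
      have "card I + card ({..<?n} - I) = ?n"
        using that by (metis card_Diff_subset card_lessThan card_mono finite_lessThan
          finite_subset le_add_diff_inverse)
      then have "(-1 :: real) ^ ?n = (-1) ^ card I * (-1) ^ card ({..<?n} - I)"
        by (metis power_add)
      then show ?thesis
        by (simp add: grade_inv_def length_nths_le that)
    qed
    then show ?thesis
      unfolding wedge_def by (subst grade_inv_def) (auto simp: sum_distrib_left intro!: sum.cong)
  qed
  then show ?thesis by (auto simp: fun_eq_iff)
qed

lemma form_eqI:
  assumes "\<And>x vs. \<alpha> x vs = \<beta> x vs" shows "\<alpha> = (\<beta> :: form)"
  using assms by (auto simp: fun_eq_iff)

text \<open>Both bracketings obey the same three-term Leibniz recursion under contraction, so no
  bijection between iterated shuffles is required.\<close>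

lemma wedge_assoc: "(\<alpha> \<and>\<^sub>F \<beta>) \<and>\<^sub>F \<gamma> = \<alpha> \<and>\<^sub>F \<beta> \<and>\<^sub>F \<gamma>"
proof (rule form_eqI)
  fix x vs
  show "((\<alpha> \<and>\<^sub>F \<beta>) \<and>\<^sub>F \<gamma>) x vs = (\<alpha> \<and>\<^sub>F \<beta> \<and>\<^sub>F \<gamma>) x vs"
    by (induction vs arbitrary: \<alpha> \<beta> \<gamma>)
       (simp_all add: wedge_Cons iota_wedge grade_inv_wedge wedge_add_left wedge_add_right)
qed

text \<open>Isolates the degree condition of \<open>one_form\<close>, which is what the sign rules
  below rest on.\<close>

definition degree1 :: "form \<Rightarrow> bool" where
  "degree1 \<alpha> \<longleftrightarrow> (\<forall>x vs. length vs \<noteq> 1 \<longrightarrow> \<alpha> x vs = 0)"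

lemma one_form_degree1: "one_form \<alpha> \<Longrightarrow> degree1 \<alpha>"
  by (simp add: one_form_def degree1_def)

lemma grade_inv_degree1:
  assumes "degree1 \<alpha>" shows "grade_inv \<alpha> = - \<alpha>"
proof (rule form_eqI)
  show "grade_inv \<alpha> x vs = (- \<alpha>) x vs" for x vs
    using assms by (cases "length vs = 1") (auto simp: degree1_def grade_inv_def)
qed

text \<open>The case of interest is the contraction of a 1-form, which has only a degree 0 part and
  so multiplies as a function.\<close>

lemma wedge_fun_form_left:
  assumes "\<And>ws. ws \<noteq> [] \<Longrightarrow> \<alpha> x ws = 0"
  shows "(\<alpha> \<and>\<^sub>F \<beta>) x vs = \<alpha> x [] * \<beta> x vs"
  using assms
proof (induction vs arbitrary: \<alpha> \<beta>)
  case (Cons v vs)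
  have "(iota v \<alpha> \<and>\<^sub>F \<beta>) x vs = 0"
    by (subst Cons.IH) (simp_all add: iota_def Cons.prems)
  moreover have "(grade_inv \<alpha> \<and>\<^sub>F iota v \<beta>) x vs = grade_inv \<alpha> x [] * iota v \<beta> x vs"
    by (rule Cons.IH) (simp add: grade_inv_def Cons.prems)
  ultimately show ?case
    by (simp add: wedge_Cons grade_inv_def iota_def)
qed simp

lemma iota_fun_form [simp]: "iota v (fun_form f) = 0"
  by (auto simp: iota_def fun_form_def fun_eq_iff)

lemma wedge_one_right [simp]: "\<alpha> \<and>\<^sub>F fun_form (\<lambda>_. 1) = \<alpha>"
proof (rule form_eqI)
  show "(\<alpha> \<and>\<^sub>F fun_form (\<lambda>_. 1)) x vs = \<alpha> x vs" for x vs
    by (induction vs arbitrary: \<alpha>) (simp_all add: wedge_Cons iota_fun_form, simp_all add: iota_def fun_form_def)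
qed

lemma wedge_degree1_Cons:
  assumes "degree1 \<alpha>"
  shows "(\<alpha> \<and>\<^sub>F \<beta>) x (v # vs) = \<alpha> x [v] * \<beta> x vs - (\<alpha> \<and>\<^sub>F iota v \<beta>) x vs"
proof -
  have "(iota v \<alpha> \<and>\<^sub>F \<beta>) x vs = iota v \<alpha> x [] * \<beta> x vs"
    using assms by (intro wedge_fun_form_left) (simp add: iota_def degree1_def)
  then show ?thesis
    by (simp add: wedge_Cons grade_inv_degree1 assms wedge_minus_left) (simp add: iota_def)
qed

lemma wedge_degree1_Nil: "degree1 \<alpha> \<Longrightarrow> (\<alpha> \<and>\<^sub>F \<beta>) x [] = 0"
  by (simp add: degree1_def)

lemma iota_wedge_degree1:
  assumes "degree1 \<alpha>"
  shows "iota v (\<alpha> \<and>\<^sub>F \<beta>) = (\<lambda>x vs. \<alpha> x [v] * \<beta> x vs) - (\<alpha> \<and>\<^sub>F iota v \<beta>)"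
  using wedge_degree1_Cons[OF assms] by (auto simp: iota_def fun_eq_iff)

lemma wedge_fun_scale_right: "(\<alpha> \<and>\<^sub>F (\<lambda>y ws. f y * \<beta> y ws)) x vs = f x * (\<alpha> \<and>\<^sub>F \<beta>) x vs"
  by (simp add: wedge_def sum_distrib_left ac_simps)

text \<open>Contracting with the first argument, the terms in which it enters
  \<open>\<alpha>\<close> or \<open>\<beta>\<close> match with opposite signs, and what remains is
  the claim for \<open>iota v \<gamma>\<close>. The trailing factor lets neighbours be exchanged
  anywhere in a right-nested product.\<close>

lemma wedge_swap:
  assumes "degree1 \<alpha>" "degree1 \<beta>"
  shows "\<alpha> \<and>\<^sub>F \<beta> \<and>\<^sub>F \<gamma> = - (\<beta> \<and>\<^sub>F \<alpha> \<and>\<^sub>F \<gamma>)"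
proof (rule form_eqI)
  fix x vs
  show "(\<alpha> \<and>\<^sub>F \<beta> \<and>\<^sub>F \<gamma>) x vs = (- (\<beta> \<and>\<^sub>F \<alpha> \<and>\<^sub>F \<gamma>)) x vs"
  proof (induction vs arbitrary: \<gamma>)
    case Nil
    then show ?case using assms by (simp add: degree1_def)
  next
    case (Cons v vs)
    show ?case
      using Cons[of "iota v \<gamma>"]
      by (simp add: wedge_degree1_Cons iota_wedge_degree1 assms wedge_diff_right
          wedge_fun_scale_right)
  qed
qed

lemma wedge_swap_last: "degree1 \<alpha> \<Longrightarrow> degree1 \<beta> \<Longrightarrow> \<alpha> \<and>\<^sub>F \<beta> = - (\<beta> \<and>\<^sub>F \<alpha>)"
  using wedge_swap[of \<alpha> \<beta> "fun_form (\<lambda>_. 1)"] by simp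

lemma form_eq_neg: "\<omega> = - \<omega> \<Longrightarrow> \<omega> = (0 :: form)"
  unfolding fun_eq_iff by (auto simp: fun_Compl_def)

lemma wedge_self: "degree1 \<alpha> \<Longrightarrow> \<alpha> \<and>\<^sub>F \<alpha> \<and>\<^sub>F \<gamma> = 0"
  by (rule form_eq_neg) (rule wedge_swap)

lemma wedge_self_last: "degree1 \<alpha> \<Longrightarrow> \<alpha> \<and>\<^sub>F \<alpha> = 0"
  by (rule form_eq_neg) (rule wedge_swap_last)

subsection \<open>The exterior derivative\<close>

definition differentiable_form :: "form \<Rightarrow> bool" where
  "differentiable_form \<omega> \<longleftrightarrow> (\<forall>x vs. (\<lambda>y. \<omega> y vs) differentiable (at x))"

definition const_deriv :: "R7 \<Rightarrow> form \<Rightarrow> form" where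
  "const_deriv v \<omega> = (\<lambda>x vs. frechet_derivative (\<lambda>y. \<omega> y vs) (at x) v)"

lemma ext_d_Nil [simp]: "ext_d \<omega> x [] = 0"
  by (simp add: ext_d_def)

text \<open>Cartan's formula for a constant vector field, along which the Lie derivative is
  \<open>const_deriv\<close>. It is the counterpart of \<open>wedge_Cons\<close> for inductions on
  the argument list.\<close>

lemma ext_d_Cons: "ext_d \<omega> x (v # vs) = const_deriv v \<omega> x vs - ext_d (iota v \<omega>) x vs"
  by (simp add: ext_d_def const_deriv_def iota_def sum.lessThan_Suc_shift sum_negf
      del: sum.lessThan_Suc)

lemma iota_ext_d: "iota v (ext_d \<omega>) = const_deriv v \<omega> - ext_d (iota v \<omega>)"
  using ext_d_Cons[of \<omega> _ v] by (auto simp: iota_def fun_eq_iff)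

lemma differentiable_iota: "differentiable_form \<omega> \<Longrightarrow> differentiable_form (iota v \<omega>)"
  by (simp add: differentiable_form_def iota_def)

lemma differentiable_grade_inv:
  "differentiable_form \<omega> \<Longrightarrow> differentiable_form (grade_inv \<omega>)"
  by (simp add: differentiable_form_def grade_inv_def)

lemma differentiable_add:
  "differentiable_form \<alpha> \<Longrightarrow> differentiable_form \<beta> \<Longrightarrow> differentiable_form (\<alpha> + \<beta>)"
  by (simp add: differentiable_form_def)

lemma differentiable_scale: "differentiable_form \<alpha> \<Longrightarrow> differentiable_form (c *\<^sub>F \<alpha>)"
  by (simp add: differentiable_form_def scale_form_def)

lemma differentiable_minus: "differentiable_form \<alpha> \<Longrightarrow> differentiable_form (- \<alpha>)"
  by (simp add: differentiable_form_def)

lemma differentiable_diff: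
  "differentiable_form \<alpha> \<Longrightarrow> differentiable_form \<beta> \<Longrightarrow> differentiable_form (\<alpha> - \<beta>)"
  by (simp add: differentiable_form_def)

lemma differentiable_wedge:
  "differentiable_form \<alpha> \<Longrightarrow> differentiable_form \<beta> \<Longrightarrow> differentiable_form (\<alpha> \<and>\<^sub>F \<beta>)"
  by (auto simp: differentiable_form_def wedge_def intro!: differentiable_sum differentiable_mult)

lemma const_deriv_eqI:
  "((\<lambda>y. \<omega> y vs) has_derivative D) (at x) \<Longrightarrow> const_deriv v \<omega> x vs = D v"
  unfolding const_deriv_def by (metis frechet_derivative_at)

lemma differentiable_form_has_derivative:
  assumes "differentiable_form \<omega>"
  shows "((\<lambda>y. \<omega> y vs) has_derivative (\<lambda>v. const_deriv v \<omega> x vs)) (at x)"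
  using assms unfolding differentiable_form_def const_deriv_def
  by (metis frechet_derivative_works)

lemma const_deriv_add:
  assumes "differentiable_form \<alpha>" "differentiable_form \<beta>"
  shows "const_deriv v (\<alpha> + \<beta>) = const_deriv v \<alpha> + const_deriv v \<beta>"
  by (rule form_eqI, subst const_deriv_eqI)
     (auto intro!: derivative_eq_intros differentiable_form_has_derivative assms)

lemma const_deriv_scale:
  assumes "differentiable_form \<alpha>"
  shows "const_deriv v (c *\<^sub>F \<alpha>) = c *\<^sub>F const_deriv v \<alpha>"
  unfolding scale_form_def
  by (rule form_eqI, subst const_deriv_eqI)
     (auto intro!: derivative_eq_intros differentiable_form_has_derivative assms)

lemma const_deriv_grade_inv:
  assumes "differentiable_form \<alpha>"
  shows "const_deriv v (grade_inv \<alpha>) = grade_inv (const_deriv v \<alpha>)"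
  unfolding grade_inv_def
  by (rule form_eqI, subst const_deriv_eqI)
     (auto intro!: derivative_eq_intros differentiable_form_has_derivative assms)

lemma const_deriv_wedge:
  assumes "differentiable_form \<alpha>" "differentiable_form \<beta>"
  shows "const_deriv v (\<alpha> \<and>\<^sub>F \<beta>) = (const_deriv v \<alpha> \<and>\<^sub>F \<beta>) + (\<alpha> \<and>\<^sub>F const_deriv v \<beta>)"
  unfolding wedge_def
  by (rule form_eqI, subst const_deriv_eqI)
     (auto intro!: derivative_eq_intros differentiable_form_has_derivative assms
       simp: sum.distrib algebra_simps)

lemma iota_add: "iota v (\<alpha> + \<beta>) = iota v \<alpha> + iota v \<beta>"
  by (auto simp: iota_def fun_eq_iff)

lemma iota_scale: "iota v (c *\<^sub>F \<alpha>) = c *\<^sub>F iota v \<alpha>"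
  by (auto simp: iota_def scale_form_def)

lemma ext_d_add:
  assumes "differentiable_form \<alpha>" "differentiable_form \<beta>"
  shows "ext_d (\<alpha> + \<beta>) = ext_d \<alpha> + ext_d \<beta>"
proof (rule form_eqI)
  show "ext_d (\<alpha> + \<beta>) x vs = (ext_d \<alpha> + ext_d \<beta>) x vs" for x vs
    using assms
    by (induction vs arbitrary: \<alpha> \<beta>)
       (simp_all add: ext_d_Cons const_deriv_add iota_add differentiable_iota)
qed

lemma ext_d_scale:
  assumes "differentiable_form \<alpha>"
  shows "ext_d (c *\<^sub>F \<alpha>) = c *\<^sub>F ext_d \<alpha>"
proof (rule form_eqI)
  show "ext_d (c *\<^sub>F \<alpha>) x vs = (c *\<^sub>F ext_d \<alpha>) x vs" for x vs
    using assms
    by (induction vs arbitrary: \<alpha>)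
       (simp_all add: ext_d_Cons const_deriv_scale iota_scale differentiable_iota
         scale_form_apply right_diff_distrib)
qed

lemma ext_d_minus: "differentiable_form \<alpha> \<Longrightarrow> ext_d (- \<alpha>) = - ext_d \<alpha>"
  by (simp add: uminus_form ext_d_scale)

lemma ext_d_diff:
  assumes "differentiable_form \<alpha>" "differentiable_form \<beta>"
  shows "ext_d (\<alpha> - \<beta>) = ext_d \<alpha> - ext_d \<beta>"
  using ext_d_add[of \<alpha> "- \<beta>"] assms by (simp add: ext_d_minus differentiable_minus)

lemma ext_d_zero [simp]: "ext_d 0 = 0"
  using ext_d_scale[of 0 0] by (simp add: scale_form_def differentiable_form_def zero_fun_def)

text \<open>The exterior derivative raises the degree by one, so it anticommutes with the grading
  sign.\<close>

lemma ext_d_grade_inv: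
  assumes "differentiable_form \<alpha>"
  shows "ext_d (grade_inv \<alpha>) = - grade_inv (ext_d \<alpha>)"
proof (rule form_eqI)
  show "ext_d (grade_inv \<alpha>) x vs = (- grade_inv (ext_d \<alpha>)) x vs" for x vs
    using assms
  proof (induction vs arbitrary: \<alpha>)
    case Nil
    then show ?case by (simp add: grade_inv_def)
  next
    case (Cons v vs)
    then have "ext_d (grade_inv (iota v \<alpha>)) x vs = (- grade_inv (ext_d (iota v \<alpha>))) x vs"
      by (simp add: differentiable_iota)
    then show ?case
      using Cons.prems
      by (simp add: ext_d_Cons iota_grade_inv const_deriv_grade_inv ext_d_minus
          differentiable_iota differentiable_grade_inv)
         (simp add: grade_inv_def ext_d_Cons algebra_simps)
  qed
qed

text \<open>By Cartan's formula the rule follows from the product rule for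
  \<open>const_deriv\<close>, the antiderivation property of contraction, and the induction
  hypothesis for the two contracted products.\<close>

lemma ext_d_wedge:
  assumes "differentiable_form \<alpha>" "differentiable_form \<beta>"
  shows "ext_d (\<alpha> \<and>\<^sub>F \<beta>) = (ext_d \<alpha> \<and>\<^sub>F \<beta>) + (grade_inv \<alpha> \<and>\<^sub>F ext_d \<beta>)"
proof (rule form_eqI)
  show "ext_d (\<alpha> \<and>\<^sub>F \<beta>) x vs = ((ext_d \<alpha> \<and>\<^sub>F \<beta>) + (grade_inv \<alpha> \<and>\<^sub>F ext_d \<beta>)) x vs" for x vs
    using assms
  proof (induction vs arbitrary: \<alpha> \<beta>)
    case (Cons v vs)
    note d = Cons.prems differentiable_iota differentiable_grade_inv differentiable_wedge
    have "ext_d (iota v \<alpha> \<and>\<^sub>F \<beta>) x vs =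
        ((ext_d (iota v \<alpha>) \<and>\<^sub>F \<beta>) + (grade_inv (iota v \<alpha>) \<and>\<^sub>F ext_d \<beta>)) x vs"
      "ext_d (grade_inv \<alpha> \<and>\<^sub>F iota v \<beta>) x vs =
        ((ext_d (grade_inv \<alpha>) \<and>\<^sub>F iota v \<beta>) + (grade_inv (grade_inv \<alpha>) \<and>\<^sub>F ext_d (iota v \<beta>))) x vs"
      by (rule Cons.IH; simp add: d)+
    then show ?case
      by (simp add: ext_d_Cons wedge_Cons iota_wedge ext_d_add d const_deriv_wedge iota_ext_d
          wedge_diff_left wedge_diff_right wedge_minus_left iota_grade_inv ext_d_grade_inv)
  qed simp
qed

lemma ext_d_wedge_degree1:
  assumes "differentiable_form \<alpha>" "differentiable_form \<beta>" "degree1 \<alpha>"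
  shows "ext_d (\<alpha> \<and>\<^sub>F \<beta>) = (ext_d \<alpha> \<and>\<^sub>F \<beta>) - (\<alpha> \<and>\<^sub>F ext_d \<beta>)"
  using assms by (simp add: ext_d_wedge grade_inv_degree1 wedge_minus_left)

lemma ext_d_const_fun [simp]: "ext_d (fun_form (\<lambda>_. c)) = 0"
proof (rule form_eqI)
  show "ext_d (fun_form (\<lambda>_. c)) x vs = 0 x vs" for x vs
    by (cases vs) (simp_all add: ext_d_Cons const_deriv_def, simp_all add: fun_form_def const_deriv_def)
qed

subsection \<open>Orthonormal coframes\<close>

declare One_nat_def [simp del]

lemma wedge_zero_at:
  assumes "\<And>ws. \<beta> x ws = 0" shows "(\<alpha> \<and>\<^sub>F \<beta>) x vs = 0"
  by (simp add: wedge_def assms)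

lemma wedge_degree1_annihilated:
  assumes "degree1 \<alpha>" "\<And>v. v \<in> set vs \<Longrightarrow> \<alpha> x [v] = 0"
  shows "(\<alpha> \<and>\<^sub>F \<beta>) x vs = 0"
  using assms(2)
  by (induction vs arbitrary: \<beta>)
     (simp_all add: wedge_degree1_Nil wedge_degree1_Cons assms(1) del: wedge_Nil)

lemma monomial_Nil: "monomial e [] = fun_form (\<lambda>_. 1)"
  by (simp add: monomial_def)

lemma monomial_Cons: "monomial e (j # js) = e j \<and>\<^sub>F monomial e js"
  by (simp add: monomial_def)

lemma C_k_const: "C_k n (\<lambda>_. c)"
  by (induction n arbitrary: c) simp_all

lemma smooth_const: "smooth (\<lambda>_. c)"
  by (simp add: smooth_def C_k_const)

lemma smooth_differentiable: "smooth f \<Longrightarrow> f differentiable (at x)"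
  unfolding smooth_def by (metis C_k.simps(2))

lemma one_form_differentiable:
  assumes "one_form \<alpha>" shows "differentiable_form \<alpha>"
  unfolding differentiable_form_def
proof (intro allI)
  fix x :: R7 and vs :: "R7 list"
  consider v where "vs = [v]" | "length vs \<noteq> 1"
    by (metis One_nat_def length_0_conv length_Suc_conv)
  then show "(\<lambda>y. \<alpha> y vs) differentiable at x"
    using assms by cases (auto simp: one_form_def intro: smooth_differentiable)
qed

text \<open>Counting inversions in a list product makes the sign computable for explicit index
  lists.\<close>

lemma shuffle_sign_lists:
  assumes "distinct js" "distinct ks"
  shows "shuffle_sign (set js) (set ks) =
    (-1) ^ length (filter (\<lambda>(i, j). j < i) (List.product js ks))"
proof -
  have "{(i, j). i \<in> set js \<and> j \<in> set ks \<and> j < i} =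
      set (filter (\<lambda>(i, j). j < i) (List.product js ks))"
    by auto
  moreover have "distinct (filter (\<lambda>(i, j). j < i) (List.product js ks))"
    using assms by (simp add: distinct_product)
  ultimately show ?thesis
    by (simp only: shuffle_sign_def distinct_card)
qed

section \<open>Linearity of frame coefficients, the Hodge star and the Clifford action\<close>

lemma frame_coeff_add: "frame_coeff E (\<alpha> + \<beta>) I x = frame_coeff E \<alpha> I x + frame_coeff E \<beta> I x"
  by (simp add: frame_coeff_def)

lemma frame_coeff_scale: "frame_coeff E (c *\<^sub>F \<alpha>) I x = c * frame_coeff E \<alpha> I x"
  by (simp add: frame_coeff_def scale_form_def)

lemma hodge_add: "hodge e E (\<alpha> + \<beta>) = hodge e E \<alpha> + hodge e E \<beta>"
  by (rule form_eqI) (simp add: hodge_def frame_coeff_add algebra_simps sum.distrib)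

lemma hodge_scale: "hodge e E (c *\<^sub>F \<alpha>) = c *\<^sub>F hodge e E \<alpha>"
  by (rule form_eqI)
     (simp add: hodge_def frame_coeff_scale sum_distrib_left ac_simps scale_form_apply)

lemma hodge_minus: "hodge e E (- \<alpha>) = - hodge e E \<alpha>"
  by (simp add: uminus_form hodge_scale)

lemma hodge_diff: "hodge e E (\<alpha> - \<beta>) = hodge e E \<alpha> - hodge e E \<beta>"
  using hodge_add[of e E \<alpha> "- \<beta>"] by (simp add: hodge_minus)

lemma clifford_action_add:
  "clifford_action E cl (\<alpha> + \<beta>) \<epsilon> x = clifford_action E cl \<alpha> \<epsilon> x + clifford_action E cl \<beta> \<epsilon> x"
  by (simp add: clifford_action_def frame_coeff_add scaleR_add_left sum.distrib)

lemma clifford_action_scale: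
  "clifford_action E cl (c *\<^sub>F \<alpha>) \<epsilon> x = c *\<^sub>R clifford_action E cl \<alpha> \<epsilon> x"
  by (simp add: clifford_action_def frame_coeff_scale scaleR_right.sum)

lemma clifford_action_minus: "clifford_action E cl (- \<alpha>) \<epsilon> x = - clifford_action E cl \<alpha> \<epsilon> x"
  by (simp add: uminus_form clifford_action_scale)

lemma clifford_action_diff:
  "clifford_action E cl (\<alpha> - \<beta>) \<epsilon> x = clifford_action E cl \<alpha> \<epsilon> x - clifford_action E cl \<beta> \<epsilon> x"
  using clifford_action_add[of E cl \<alpha> "- \<beta>"] by (simp add: clifford_action_minus)

lemma clifford_action_zero: "clifford_action E cl 0 \<epsilon> x = 0"
  by (simp add: clifford_action_def frame_coeff_def)

lemma scale_scale: "c *\<^sub>F d *\<^sub>F \<omega> = (c * d) *\<^sub>F \<omega>"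
  by (simp add: scale_form_def mult.assoc)

lemma scale_add: "c *\<^sub>F (\<alpha> + \<beta>) = c *\<^sub>F \<alpha> + c *\<^sub>F \<beta>"
  by (rule form_eqI) (simp add: scale_form_apply algebra_simps)

lemma scale_diff: "c *\<^sub>F (\<alpha> - \<beta>) = c *\<^sub>F \<alpha> - c *\<^sub>F \<beta>"
  by (rule form_eqI) (simp add: scale_form_apply algebra_simps)

lemma scale_minus: "c *\<^sub>F (- \<alpha>) = - (c *\<^sub>F \<alpha>)"
  by (rule form_eqI) (simp add: scale_form_apply)

lemma minus_scale: "(- c) *\<^sub>F \<alpha> = - (c *\<^sub>F \<alpha>)"
  by (rule form_eqI) (simp add: scale_form_apply)

lemma scale_one [simp]: "1 *\<^sub>F \<omega> = \<omega>"
  by (simp add: scale_form_def)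

lemma zero_scale [simp]: "0 *\<^sub>F \<omega> = 0"
  by (rule form_eqI) (simp add: scale_form_def)

lemma scale_zero [simp]: "c *\<^sub>F 0 = 0"
  by (rule form_eqI) (simp add: scale_form_def)

lemmas wedge_linear = wedge_add_left wedge_add_right wedge_diff_left wedge_diff_right
  wedge_minus_left wedge_minus_right wedge_scale_left wedge_scale_right

lemmas scale_linear = scale_scale scale_add scale_diff scale_minus minus_scale

lemmas hodge_linear = hodge_add hodge_diff hodge_minus hodge_scale

lemmas clifford_action_linear = clifford_action_add clifford_action_diff clifford_action_minus
  clifford_action_scale clifford_action_zero

lemmas ext_d_linear = ext_d_add ext_d_diff ext_d_minus ext_d_scale

lemmas differentiable_form_intros = differentiable_add differentiable_diff differentiable_minus
  differentiable_scale differentiable_wedge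

section \<open>A coframe with its dual frame\<close>

locale coframe =
  fixes e :: "nat \<Rightarrow> form" and E :: "nat \<Rightarrow> R7 \<Rightarrow> R7"
  assumes one_form_e: "i \<in> {1..7} \<Longrightarrow> one_form (e i)"
    and dual: "dual_frame e E"
begin

lemma degree1_e: "i \<in> {1..7} \<Longrightarrow> degree1 (e i)"
  by (simp add: one_form_e one_form_degree1)

lemma differentiable_e: "i \<in> {1..7} \<Longrightarrow> differentiable_form (e i)"
  by (simp add: one_form_e one_form_differentiable)

lemma linear_e: "i \<in> {1..7} \<Longrightarrow> linear (\<lambda>v. e i x [v])"
  using one_form_e by (simp add: one_form_def)

lemma smooth_E: "j \<in> {1..7} \<Longrightarrow> smooth (E j)"
  using dual by (simp add: dual_frame_def)

lemma e_E: "i \<in> {1..7} \<Longrightarrow> j \<in> {1..7} \<Longrightarrow> e i x [E j x] = (if i = j then 1 else 0)"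
  using dual by (simp add: dual_frame_def)

text \<open>The duality relations make the seven vectors \<open>E i x\<close> independent, hence
  spanning; both sides are linear in \<open>v\<close>, so it is enough to compare them on the
  frame.\<close>

lemma frame_expand: "v = (\<Sum>i=1..7. e i x [v] *\<^sub>R E i x)"
proof -
  let ?B = "(\<lambda>i. E i x) ` {1..7}"
  have inj: "inj_on (\<lambda>i. E i x) {1..7}"
    by (rule inj_onI) (metis e_E zero_neq_one)
  have "independent ?B"
  proof (rule independent_if_scalars_zero)
    show "finite ?B" by simp
    fix f u assume sum0: "(\<Sum>u\<in>?B. f u *\<^sub>R u) = 0" and "u \<in> ?B"
    then obtain j where j: "j \<in> {1..7}" "u = E j x" by auto
    have "0 = e j x [\<Sum>i=1..7. f (E i x) *\<^sub>R E i x]"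
      using sum0 linear_0[OF linear_e[OF j(1)]] by (simp add: sum.reindex[OF inj])
    also have "\<dots> = (\<Sum>i=1..7. f (E i x) * e j x [E i x])"
      by (simp add: linear_sum[OF linear_e[OF j(1)]] linear_cmul[OF linear_e[OF j(1)]])
    also have "\<dots> = (\<Sum>i=1..7. if i = j then f (E i x) else 0)"
      by (rule sum.cong) (use j e_E in auto)
    finally show "f u = 0" using j by simp
  qed
  moreover have "card ?B = DIM(R7)"
    by (simp add: card_image[OF inj])
  ultimately have "span ?B = UNIV"
    by (metis card_ge_dim_independent dim_UNIV order_refl subset_UNIV top.extremum_uniqueI)
  then have "v \<in> span ?B" by simp
  then show ?thesis
  proof (induction rule: span_induct)
    show "subspace {v. v = (\<Sum>i=1..7. e i x [v] *\<^sub>R E i x)}"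
    proof (rule subspaceI; simp only: mem_Collect_eq)
      show "0 = (\<Sum>i=1..7. e i x [0] *\<^sub>R E i x)"
        by (simp add: linear_0[OF linear_e])
    next
      fix u w
      assume "u = (\<Sum>i=1..7. e i x [u] *\<^sub>R E i x)" "w = (\<Sum>i=1..7. e i x [w] *\<^sub>R E i x)"
      moreover have "(\<Sum>i=1..7. e i x [u + w] *\<^sub>R E i x) =
          (\<Sum>i=1..7. e i x [u] *\<^sub>R E i x) + (\<Sum>i=1..7. e i x [w] *\<^sub>R E i x)"
        by (simp add: linear_add[OF linear_e] scaleR_add_left sum.distrib)
      ultimately show "u + w = (\<Sum>i=1..7. e i x [u + w] *\<^sub>R E i x)" by simp
    next
      fix c u
      assume "u = (\<Sum>i=1..7. e i x [u] *\<^sub>R E i x)"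
      moreover have "(\<Sum>i=1..7. e i x [c *\<^sub>R u] *\<^sub>R E i x) = c *\<^sub>R (\<Sum>i=1..7. e i x [u] *\<^sub>R E i x)"
        by (simp add: linear_cmul[OF linear_e] scaleR_right.sum)
      ultimately show "c *\<^sub>R u = (\<Sum>i=1..7. e i x [c *\<^sub>R u] *\<^sub>R E i x)" by simp
    qed
  next
    fix u assume "u \<in> ?B"
    then obtain j where j: "j \<in> {1..7}" "u = E j x" by auto
    have "(\<Sum>i=1..7. e i x [u] *\<^sub>R E i x) = (\<Sum>i=1..7. if i = j then E i x else 0)"
      by (rule sum.cong) (use j e_E in auto)
    then show "u = (\<Sum>i=1..7. e i x [u] *\<^sub>R E i x)" using j by simp
  qed
qed

lemma frame_eqI: "(\<And>i. i \<in> {1..7} \<Longrightarrow> e i x [u] = e i x [v]) \<Longrightarrow> u = v"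
  by (subst frame_expand[of u x], subst frame_expand[of v x]) (rule sum.cong, auto)

text \<open>\<open>const_deriv\<close> differentiates with fixed arguments, whereas here the
  argument moves too. Expanding it in the standard basis turns the evaluation into a finite sum of
  products, to which the product rule applies.\<close>

lemma e_has_derivative:
  assumes i: "i \<in> {1..7}" and Y: "(Y has_derivative Y') (at x)"
  shows "((\<lambda>y. e i y [Y y]) has_derivative
    (\<lambda>u. const_deriv u (e i) x [Y x] + e i x [Y' u])) (at x)"
proof -
  have expand: "e i y [w] = (\<Sum>b\<in>Basis. (w \<bullet> b) * e i y [b])" for y w
    by (subst (1) euclidean_representation[of w, symmetric])
       (simp add: linear_sum[OF linear_e[OF i]] linear_cmul[OF linear_e[OF i]])
  have d: "((\<lambda>y. e i y vs) has_derivative (\<lambda>v. const_deriv v (e i) x vs)) (at x)" for vs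
    by (rule differentiable_form_has_derivative) (rule differentiable_e[OF i])
  have 1: "((\<lambda>y. e i y [w]) has_derivative
      (\<lambda>u. \<Sum>b\<in>Basis. (w \<bullet> b) * const_deriv u (e i) x [b])) (at x)" for w
    by (subst expand) (auto intro!: derivative_eq_intros d)
  then have 2: "const_deriv u (e i) x [w] = (\<Sum>b\<in>Basis. (w \<bullet> b) * const_deriv u (e i) x [b])" for u w
    by (rule const_deriv_eqI)
  have "((\<lambda>y. e i y [Y y]) has_derivative
      (\<lambda>u. \<Sum>b\<in>Basis. (Y x \<bullet> b) * const_deriv u (e i) x [b] + (Y' u \<bullet> b) * e i x [b])) (at x)"
    by (subst expand) (auto intro!: derivative_eq_intros d Y)
  then show ?thesis
    by (simp add: sum.distrib flip: 2 expand)
qed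

lemma monomial_annihilated:
  assumes "set js \<subseteq> {1..7}" "\<And>k. k \<in> set js \<Longrightarrow> e k x [v] = 0"
  shows "monomial e js x (v # vs) = 0"
  using assms
proof (induction js arbitrary: vs)
  case (Cons k js)
  then have "(e k \<and>\<^sub>F iota v (monomial e js)) x vs = 0"
    by (intro wedge_zero_at) (simp add: iota_def)
  with Cons.prems show ?case
    by (simp add: monomial_Cons wedge_degree1_Cons degree1_e)
qed (simp add: monomial_Nil fun_form_def)

text \<open>Compare the leading indices of the two increasing lists. If they agree, strip both; if
  the vector has the smaller index, every factor kills it; if the factor has the smaller index, it
  kills every vector.\<close>

lemma monomial_frame:
  assumes "set js \<subseteq> {1..7}" "set is \<subseteq> {1..7}" "sorted_wrt (<) js" "sorted_wrt (<) is"
  shows "monomial e js x (map (\<lambda>i. E i x) is) = (if is = js then 1 else 0)"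
  using assms
proof (induction js arbitrary: "is")
  case Nil
  then show ?case by (simp add: monomial_Nil fun_form_def)
next
  case (Cons j js)
  have j: "degree1 (e j)" "j \<in> {1..7}" using Cons.prems by (auto intro: degree1_e)
  have vanish: "(e j \<and>\<^sub>F \<beta>) x (map (\<lambda>i. E i x) ks) = 0"
    if "j \<notin> set ks" "set ks \<subseteq> {1..7}" for ks \<beta>
  proof (rule wedge_degree1_annihilated[OF j(1)])
    fix v assume "v \<in> set (map (\<lambda>i. E i x) ks)"
    then obtain i where "i \<in> set ks" "v = E i x" by auto
    then show "e j x [v] = 0" using that e_E[OF j(2), of i x] by auto
  qed
  show ?case
  proof (cases "is")
    case Nil
    then show ?thesis using j by (simp add: monomial_Cons wedge_degree1_Nil del: wedge_Nil)
  next
    case (Cons i is')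
    consider "i = j" | "i < j" | "j < i" by linarith
    then show ?thesis
    proof cases
      case 1
      then have "monomial e (j # js) x (map (\<lambda>i. E i x) is) =
          monomial e js x (map (\<lambda>i. E i x) is') - 0"
        unfolding Cons monomial_Cons list.map wedge_degree1_Cons[OF j(1)]
        using Cons Cons.prems j by (subst vanish) (auto simp: e_E)
      also have "\<dots> = (if is' = js then 1 else 0)"
        using Cons.IH[of is'] Cons Cons.prems by simp
      finally show ?thesis using 1 Cons by simp
    next
      case 2
      have "monomial e (j # js) x (map (\<lambda>i. E i x) is) = 0"
        unfolding Cons list.map
      proof (rule monomial_annihilated)
        show "set (j # js) \<subseteq> {1..7}" by fact
        show "e k x [E i x] = 0" if "k \<in> set (j # js)" for k
          using that 2 Cons Cons.prems by (subst e_E) auto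
      qed
      then show ?thesis using 2 Cons by simp
    next
      case 3
      then have "monomial e (j # js) x (map (\<lambda>i. E i x) is) = 0"
        unfolding monomial_Cons using Cons Cons.prems by (intro vanish) auto
      then show ?thesis using 3 Cons by simp
    qed
  qed
qed

lemma frame_coeff_monomial:
  assumes "set js \<subseteq> {1..7}" "sorted_wrt (<) js" "I \<subseteq> {1..7}"
  shows "frame_coeff E (monomial e js) I x = (if I = set js then 1 else 0)"
proof -
  have fin: "finite I" using assms(3) finite_subset by blast
  have "frame_coeff E (monomial e js) I x = (if sorted_list_of_set I = js then 1 else 0)"
    unfolding frame_coeff_def by (rule monomial_frame) (use assms fin in auto)
  also have "sorted_list_of_set I = js \<longleftrightarrow> I = set js"
    using assms(2) fin by (metis sorted_list_of_set.idem_if_sorted_distinct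
        sorted_list_of_set.set_sorted_key_list_of_set strict_sorted_iff)
  finally show ?thesis .
qed

text \<open>One subset survives in the defining sum. With the complement supplied as a list, both
  the dual monomial and its sign are found by evaluation.\<close>

lemma hodge_monomial:
  assumes "sorted_wrt (<) js" "sorted_wrt (<) ks" "set js \<inter> set ks = {}"
    "set js \<union> set ks = {1..7}"
  shows "hodge e E (monomial e js) =
    (-1) ^ length (filter (\<lambda>(i, j). j < i) (List.product js ks)) *\<^sub>F monomial e ks"
proof (rule form_eqI)
  fix x vs
  have js: "set js \<subseteq> {1..7}" and ks: "{1..7} - set js = set ks" using assms by auto
  have "hodge e E (monomial e js) x vs = (\<Sum>I \<in> Pow {1..7}. if I = set js then
      shuffle_sign I ({1..7} - I) * monomial e (sorted_list_of_set ({1..7} - I)) x vs else 0)"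
    unfolding hodge_def by (rule sum.cong) (auto simp: frame_coeff_monomial js assms(1))
  also have "\<dots> = shuffle_sign (set js) (set ks) * monomial e ks x vs"
    using js assms(2)
    by (simp add: ks sorted_list_of_set.idem_if_sorted_distinct strict_sorted_iff)
  finally show "hodge e E (monomial e js) x vs =
    ((-1) ^ length (filter (\<lambda>(i, j). j < i) (List.product js ks)) *\<^sub>F monomial e ks) x vs"
    using assms(1,2) by (simp add: scale_form_apply shuffle_sign_lists strict_sorted_iff)
qed

lemma clifford_action_monomial:
  assumes "sorted_wrt (<) js" "set js \<subseteq> {1..7}"
  shows "clifford_action E cl (monomial e js) \<epsilon> x = foldr cl js (\<epsilon> x)"
proof -
  have "clifford_action E cl (monomial e js) \<epsilon> x =
      (\<Sum>I \<in> Pow {1..7}. if I = set js then foldr cl (sorted_list_of_set I) (\<epsilon> x) else 0)"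
    unfolding clifford_action_def by (rule sum.cong) (auto simp: frame_coeff_monomial assms)
  then show ?thesis
    using assms by (simp add: sorted_list_of_set.idem_if_sorted_distinct strict_sorted_iff)
qed

lemma e_swap:
  "i < j \<Longrightarrow> i \<in> {1..7} \<Longrightarrow> j \<in> {1..7} \<Longrightarrow> e j \<and>\<^sub>F e i \<and>\<^sub>F \<omega> = - (e i \<and>\<^sub>F e j \<and>\<^sub>F \<omega>)"
  by (intro wedge_swap degree1_e)

lemma e_swap_last:
  "i < j \<Longrightarrow> i \<in> {1..7} \<Longrightarrow> j \<in> {1..7} \<Longrightarrow> e j \<and>\<^sub>F e i = - (e i \<and>\<^sub>F e j)"
  by (intro wedge_swap_last degree1_e)

lemma e_self: "i \<in> {1..7} \<Longrightarrow> e i \<and>\<^sub>F e i \<and>\<^sub>F \<omega> = 0" "i \<in> {1..7} \<Longrightarrow> e i \<and>\<^sub>F e i = 0"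
  by (simp_all add: wedge_self wedge_self_last degree1_e)

lemma ext_d_e_wedge:
  assumes "i \<in> {1..7}" "differentiable_form \<beta>"
  shows "ext_d (e i \<and>\<^sub>F \<beta>) = (ext_d (e i) \<and>\<^sub>F \<beta>) - (e i \<and>\<^sub>F ext_d \<beta>)"
  using assms by (simp add: ext_d_wedge_degree1 differentiable_e degree1_e)

text \<open>A rewrite system that brings every product to right-nested monomials with increasing
  indices and drops repeated factors; the order condition in \<open>e_swap\<close> makes it
  terminate. Identities of forms thereby become polynomial identities between coefficients.\<close>

lemmas wedge_normalize = wedge_linear scale_linear wedge_assoc e_swap e_swap_last e_self
  monomial_Cons monomial_Nil

end

subsection \<open>Connections in an invariant frame\<close>

lemma ext_d_pair:
  "ext_d \<omega> x [u, v] = const_deriv u \<omega> x [v] - const_deriv v \<omega> x [u]"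
  by (simp add: ext_d_Cons) (simp add: const_deriv_def iota_def)

lemma ext_d_pair_skew: "ext_d \<omega> x [u, v] = - ext_d \<omega> x [v, u]"
  by (simp add: ext_d_pair)

lemma wedge_degree1_pair:
  assumes "degree1 \<alpha>"
  shows "(\<alpha> \<and>\<^sub>F \<beta>) x [u, v] = \<alpha> x [u] * \<beta> x [v] - \<alpha> x [v] * \<beta> x [u]"
  using assms
  by (simp add: wedge_degree1_Cons wedge_degree1_Nil iota_def del: wedge_Nil)

lemma wedge_degree1_triple:
  assumes "degree1 \<alpha>"
  shows "(\<alpha> \<and>\<^sub>F \<beta>) x [u, v, w] =
    \<alpha> x [u] * \<beta> x [v, w] - \<alpha> x [v] * \<beta> x [u, w] + \<alpha> x [w] * \<beta> x [u, v]"
  using assms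
  by (simp add: wedge_degree1_Cons wedge_degree1_Nil iota_def del: wedge_Nil)

lemma sum_form_apply: "(\<Sum>i\<in>S. \<omega> i) x vs = (\<Sum>i\<in>S. (\<omega> i :: form) x vs)"
  by (induction S rule: infinite_finite_induct) simp_all

locale invariant_coframe = coframe +
  fixes G :: "R7 monoid" and \<Gamma> :: "R7 set"
  assumes invariant: "i \<in> {1..7} \<Longrightarrow> invariant_form G (carrier G) (e i)"
    and carrier: "\<Gamma> \<subseteq> carrier G"
begin

lemma E_vfield:
  assumes j: "j \<in> {1..7}" shows "E j \<in> vfields_on G \<Gamma>"
proof -
  have "E j (g \<otimes>\<^bsub>G\<^esub> x) = frechet_derivative (\<lambda>y. g \<otimes>\<^bsub>G\<^esub> y) (at x) (E j x)"
    if g: "g \<in> \<Gamma>" for g x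
  proof (rule frame_eqI)
    fix i assume i: "i \<in> {1..7::nat}"
    have "pullback (\<lambda>y. g \<otimes>\<^bsub>G\<^esub> y) (e i) x [E j x] = e i x [E j x]"
      using invariant[OF i] carrier g by (auto simp: invariant_form_def)
    then show "e i (g \<otimes>\<^bsub>G\<^esub> x) [E j (g \<otimes>\<^bsub>G\<^esub> x)] =
        e i (g \<otimes>\<^bsub>G\<^esub> x) [frechet_derivative (\<lambda>y. g \<otimes>\<^bsub>G\<^esub> y) (at x) (E j x)]"
      using e_E[OF i j] by (simp add: pullback_def)
  qed
  then show ?thesis
    using smooth_E[OF j] by (simp add: vfields_on_def)
qed

lemma metric_E: "k \<in> {1..7} \<Longrightarrow> metric e x u (E k x) = e k x [u]"
proof -
  assume k: "k \<in> {1..7}"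
  have "metric e x u (E k x) = (\<Sum>i=1..7. if i = k then e i x [u] else 0)"
    unfolding metric_def by (rule sum.cong) (use k e_E in auto)
  then show ?thesis using k by simp
qed

lemma metric_E': "k \<in> {1..7} \<Longrightarrow> metric e x (E k x) u = e k x [u]"
  using metric_E[of k x u] by (simp add: metric_def mult.commute)

text \<open>The function \<open>e i\<close> on \<open>E l\<close> is constant; differentiating it
  trades derivatives of the form for derivatives of the field, and the antisymmetrisation is the
  bracket.\<close>

lemma ext_d_e_E:
  assumes i: "i \<in> {1..7}" and j: "j \<in> {1..7}" and k: "k \<in> {1..7}"
  shows "ext_d (e i) x [E j x, E k x] = - e i x [lie_bracket (E j) (E k) x]"
proof -
  have *: "const_deriv u (e i) x [E l x] = - e i x [frechet_derivative (E l) (at x) u]"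
    if l: "l \<in> {1..7}" for l u
  proof -
    have "(E l has_derivative frechet_derivative (E l) (at x)) (at x)"
      using smooth_E[OF l] smooth_differentiable frechet_derivative_works by blast
    from e_has_derivative[OF i this]
    have "((\<lambda>y. if i = l then 1 else 0 :: real) has_derivative
        (\<lambda>u. const_deriv u (e i) x [E l x] + e i x [frechet_derivative (E l) (at x) u])) (at x)"
      by (simp only: e_E[OF i l])
    from has_derivative_unique[OF this has_derivative_const]
    have "const_deriv u (e i) x [E l x] + e i x [frechet_derivative (E l) (at x) u] = 0"
      by (rule fun_cong)
    then show ?thesis by simp
  qed
  show ?thesis
    using j k by (simp add: ext_d_pair * lie_bracket_def dir_deriv_def linear_diff[OF linear_e[OF i]])
qed

text \<open>Differentiate the constant function g(E_j, E_i).\<close>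

lemma metric_connection_skew:
  assumes "metric_connection G \<Gamma> e nabla" and i: "i \<in> {1..7}" and j: "j \<in> {1..7}" and k: "k \<in> {1..7}"
  shows "e i x [nabla (E k) (E j) x] = - e j x [nabla (E k) (E i) x]"
proof -
  have "dir_deriv (E k) (\<lambda>y. metric e y (E j y) (E i y)) x =
      metric e x (nabla (E k) (E j) x) (E i x) + metric e x (E j x) (nabla (E k) (E i) x)"
    using assms(1) E_vfield i j k by (simp add: metric_connection_def)
  moreover have "(\<lambda>y. metric e y (E j y) (E i y)) = (\<lambda>y. if i = j then 1 else 0)"
    using i j by (auto simp: metric_E e_E)
  ultimately show ?thesis
    using i j by (simp add: metric_E metric_E' dir_deriv_def split: if_splits)
qed

lemma conn_form_skew:
  assumes "metric_connection G \<Gamma> e nabla" "i \<in> {1..7}" "j \<in> {1..7}"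
  shows "conn_form e E nabla i j = - conn_form e E nabla j i"
proof (rule form_eqI)
  fix x vs
  have "e i x [nabla (E k) (E j) x] * e k x vs = - (e j x [nabla (E k) (E i) x] * e k x vs)"
    if "k \<in> {1..7}" for k
    using metric_connection_skew[OF assms that, of x] by simp
  then show "conn_form e E nabla i j x vs = (- conn_form e E nabla j i) x vs"
    by (simp add: conn_form_def sum_form_apply sum_negf[symmetric])
qed

text \<open>Koszul's formula in an orthonormal frame, where the derivatives of the metric
  coefficients drop out.\<close>

lemma levi_civita_coeff:
  assumes lc: "levi_civita G \<Gamma> e nabla" and i: "i \<in> {1..7}" and j: "j \<in> {1..7}" and k: "k \<in> {1..7}"
  defines "D \<equiv> \<lambda>i j k x. ext_d (e i) x [E j x, E k x]"
  shows "e i x [nabla (E k) (E j) x] = (D k j i x - D i k j x - D j i k x) / 2"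
proof -
  have skew: "e i x [nabla (E k) (E j) x] = - e j x [nabla (E k) (E i) x]"
    if "i \<in> {1..7}" "j \<in> {1..7}" "k \<in> {1..7}" for i j k
    using lc that by (intro metric_connection_skew) (auto simp: levi_civita_def)
  have tors: "e i x [nabla (E k) (E j) x] - e i x [nabla (E j) (E k) x] = - D i k j x"
    if "i \<in> {1..7}" "j \<in> {1..7}" "k \<in> {1..7}" for i j k
  proof -
    have "nabla (E k) (E j) x - nabla (E j) (E k) x = lie_bracket (E k) (E j) x"
      using lc E_vfield that by (simp add: levi_civita_def)
    then show ?thesis
      using that by (simp add: D_def ext_d_e_E flip: linear_diff[OF linear_e])
  qed
  show ?thesis
    \<comment> \<open>Skewness and vanishing torsion under the three cyclic permutations form a
      linear system that determines the coefficient.\<close>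
    using skew[OF i j k] skew[OF j k i] skew[OF k i j] tors[OF i j k] tors[OF j k i] tors[OF k i j]
    by argo
qed

text \<open>For this torsion, the terms of Koszul's formula other than $de^k(E_j,E_i)$ cancel.\<close>

lemma torsion_conn_form:
  assumes lc: "levi_civita G \<Gamma> e nabla" and shift: "torsion_shift G \<Gamma> e nabla T nabla'"
    and T: "T = (\<Sum>m=1..7. e m \<and>\<^sub>F ext_d (e m))"
    and i: "i \<in> {1..7}" and j: "j \<in> {1..7}"
  shows "conn_form e E nabla' i j = (\<Sum>k=1..7. (\<lambda>x vs. ext_d (e k) x [E j x, E i x] * e k x vs))"
proof -
  define D where "D = (\<lambda>i j k x. ext_d (e i) x [E j x, E k x])"
  have skew: "D m a b x = - D m b a x" for m a b x
    by (simp add: D_def ext_d_pair_skew[of _ _ "E a x"])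
  have "e i x [nabla' (E k) (E j) x] = D k j i x" if k: "k \<in> {1..7}" for k x
  proof -
    \<comment> \<open>Only m equal to one of the three indices contributes, which leaves the cyclic
      sum of de^k(E_j, E_i).\<close>
    have "T x [E k x, E j x, E i x] =
        (\<Sum>m=1..7. (if m = k then D m j i x else 0) - (if m = j then D m k i x else 0)
          + (if m = i then D m k j x else 0))"
      unfolding T sum_form_apply
      by (rule sum.cong) (use i j k e_E in \<open>auto simp: wedge_degree1_triple degree1_e D_def\<close>)
    also have "\<dots> = D k j i x + D j i k x + D i k j x"
      using i j k skew[of j i k x] by (simp add: sum.distrib sum_subtractf)
    finally have "T x [E k x, E j x, E i x] = D k j i x + D j i k x + D i k j x" .
    moreover have "metric e x (nabla' (E k) (E j) x) (E i x) =
        metric e x (nabla (E k) (E j) x) (E i x) + 1/2 * T x [E k x, E j x, E i x]"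
      using shift E_vfield i j k by (simp add: torsion_shift_def)
    \<comment> \<open>Half the cyclic sum cancels the two negative Koszul terms and completes the
      remaining half to the full coefficient.\<close>
    ultimately show ?thesis
      using levi_civita_coeff[OF lc i j k, of x] i by (simp add: metric_E D_def, argo)
  qed
  then show ?thesis
    by (intro form_eqI) (simp add: conn_form_def sum_form_apply D_def)
qed

end

subsection \<open>The nilmanifold\<close>

lemma interval7: "{1..7::nat} = {1, 2, 3, 4, 5, 6, 7}"
  by auto

lemma sum7: "(\<Sum>i=1..7::nat. f i) = f 1 + f 2 + f 3 + f 4 + f 5 + f 6 + (f 7 :: 'a::comm_monoid_add)"
  by (simp add: interval7 add.assoc)

lemma sum_pairs7:
  "(\<Sum>j=1..7::nat. \<Sum>i=1..<j. f i j) =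
    f 1 2 + (f 1 3 + f 2 3) + (f 1 4 + f 2 4 + f 3 4) + (f 1 5 + f 2 5 + f 3 5 + f 4 5)
    + (f 1 6 + f 2 6 + f 3 6 + f 4 6 + f 5 6)
    + (f 1 7 + f 2 7 + f 3 7 + f 4 7 + f 5 7 + (f 6 7 :: 'a::comm_monoid_add))"
proof -
  have "{1..<1} = ({} :: nat set)" "{1..<2} = {1::nat}" "{1..<3} = {1, 2::nat}"
    "{1..<4} = {1, 2, 3::nat}" "{1..<5} = {1, 2, 3, 4::nat}"
    "{1..<6} = {1, 2, 3, 4, 5::nat}" "{1..<7} = {1, 2, 3, 4, 5, 6::nat}"
    by auto
  then show ?thesis by (simp add: sum7 add.assoc)
qed

locale nil_coframe = invariant_coframe +
  fixes t c1 c2 :: real and \<Theta> T :: form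
  assumes closed: "\<forall>i\<in>{1..5}. ext_d (e i) = 0"
    and ext_d_6: "ext_d (e 6) = (- 2 * t) *\<^sub>F (monomial e [1,2] - monomial e [3,4])"
    and ext_d_7: "ext_d (e 7) = c1 *\<^sub>F (monomial e [1,3] + monomial e [2,4])
      + c2 *\<^sub>F (monomial e [1,4] - monomial e [2,3])"
    and Theta: "\<Theta> = (monomial e [1,2] + monomial e [3,4] + monomial e [5,6]) \<and>\<^sub>F e 7
      + monomial e [1,3,5] - monomial e [1,4,6] - monomial e [2,3,6] - monomial e [2,4,5]"
    and T: "T = - hodge e E (ext_d \<Theta>)"
begin

lemma ext_d_e:
  "ext_d (e 1) = 0" "ext_d (e 2) = 0" "ext_d (e 3) = 0" "ext_d (e 4) = 0" "ext_d (e 5) = 0"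
  "ext_d (e 6) = (- 2 * t) *\<^sub>F ((e 1 \<and>\<^sub>F e 2) - (e 3 \<and>\<^sub>F e 4))"
  "ext_d (e 7) = c1 *\<^sub>F ((e 1 \<and>\<^sub>F e 3) + (e 2 \<and>\<^sub>F e 4)) + c2 *\<^sub>F ((e 1 \<and>\<^sub>F e 4) - (e 2 \<and>\<^sub>F e 3))"
  using closed ext_d_6 ext_d_7 by (simp_all add: monomial_Cons monomial_Nil)

lemmas ext_d_normalize = ext_d_linear ext_d_e_wedge ext_d_e differentiable_form_intros
  differentiable_e

section \<open>The 3-form, its Hodge dual and its torsion\<close>

lemma Theta_eq:
  "\<Theta> = (e 1 \<and>\<^sub>F e 2 \<and>\<^sub>F e 7) + (e 3 \<and>\<^sub>F e 4 \<and>\<^sub>F e 7) + (e 5 \<and>\<^sub>F e 6 \<and>\<^sub>F e 7) + (e 1 \<and>\<^sub>F e 3 \<and>\<^sub>F e 5)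
    - (e 1 \<and>\<^sub>F e 4 \<and>\<^sub>F e 6) - (e 2 \<and>\<^sub>F e 3 \<and>\<^sub>F e 6) - (e 2 \<and>\<^sub>F e 4 \<and>\<^sub>F e 5)"
  unfolding Theta by (simp add: wedge_normalize)

text \<open>Only e^{567} contributes: in the derivatives of the other monomials containing e^6 or
  e^7, each product of 2-forms on the 4-plane repeats an index.\<close>

lemma ext_d_Theta:
  "ext_d \<Theta> = (2 * t) *\<^sub>F ((e 1 \<and>\<^sub>F e 2 \<and>\<^sub>F e 5 \<and>\<^sub>F e 7) - (e 3 \<and>\<^sub>F e 4 \<and>\<^sub>F e 5 \<and>\<^sub>F e 7))
    + c1 *\<^sub>F ((e 1 \<and>\<^sub>F e 3 \<and>\<^sub>F e 5 \<and>\<^sub>F e 6) + (e 2 \<and>\<^sub>F e 4 \<and>\<^sub>F e 5 \<and>\<^sub>F e 6))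
    + c2 *\<^sub>F ((e 1 \<and>\<^sub>F e 4 \<and>\<^sub>F e 5 \<and>\<^sub>F e 6) - (e 2 \<and>\<^sub>F e 3 \<and>\<^sub>F e 5 \<and>\<^sub>F e 6))"
  unfolding Theta_eq
  by (rule form_eqI) (simp add: ext_d_normalize wedge_normalize scale_form_apply algebra_simps)

lemma hodge_table:
  shows "hodge e E (e 1 \<and>\<^sub>F e 2 \<and>\<^sub>F e 7) = e 3 \<and>\<^sub>F e 4 \<and>\<^sub>F e 5 \<and>\<^sub>F e 6"
    and "hodge e E (e 3 \<and>\<^sub>F e 4 \<and>\<^sub>F e 7) = e 1 \<and>\<^sub>F e 2 \<and>\<^sub>F e 5 \<and>\<^sub>F e 6"
    and "hodge e E (e 5 \<and>\<^sub>F e 6 \<and>\<^sub>F e 7) = e 1 \<and>\<^sub>F e 2 \<and>\<^sub>F e 3 \<and>\<^sub>F e 4"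
    and "hodge e E (e 1 \<and>\<^sub>F e 3 \<and>\<^sub>F e 5) = - (e 2 \<and>\<^sub>F e 4 \<and>\<^sub>F e 6 \<and>\<^sub>F e 7)"
    and "hodge e E (e 1 \<and>\<^sub>F e 4 \<and>\<^sub>F e 6) = - (e 2 \<and>\<^sub>F e 3 \<and>\<^sub>F e 5 \<and>\<^sub>F e 7)"
    and "hodge e E (e 2 \<and>\<^sub>F e 3 \<and>\<^sub>F e 6) = - (e 1 \<and>\<^sub>F e 4 \<and>\<^sub>F e 5 \<and>\<^sub>F e 7)"
    and "hodge e E (e 2 \<and>\<^sub>F e 4 \<and>\<^sub>F e 5) = - (e 1 \<and>\<^sub>F e 3 \<and>\<^sub>F e 6 \<and>\<^sub>F e 7)"
    and "hodge e E (e 1 \<and>\<^sub>F e 2 \<and>\<^sub>F e 5 \<and>\<^sub>F e 7) = - (e 3 \<and>\<^sub>F e 4 \<and>\<^sub>F e 6)"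
    and "hodge e E (e 3 \<and>\<^sub>F e 4 \<and>\<^sub>F e 5 \<and>\<^sub>F e 7) = - (e 1 \<and>\<^sub>F e 2 \<and>\<^sub>F e 6)"
    and "hodge e E (e 1 \<and>\<^sub>F e 3 \<and>\<^sub>F e 5 \<and>\<^sub>F e 6) = - (e 2 \<and>\<^sub>F e 4 \<and>\<^sub>F e 7)"
    and "hodge e E (e 2 \<and>\<^sub>F e 4 \<and>\<^sub>F e 5 \<and>\<^sub>F e 6) = - (e 1 \<and>\<^sub>F e 3 \<and>\<^sub>F e 7)"
    and "hodge e E (e 1 \<and>\<^sub>F e 4 \<and>\<^sub>F e 5 \<and>\<^sub>F e 6) = e 2 \<and>\<^sub>F e 3 \<and>\<^sub>F e 7"
    and "hodge e E (e 2 \<and>\<^sub>F e 3 \<and>\<^sub>F e 5 \<and>\<^sub>F e 6) = e 1 \<and>\<^sub>F e 4 \<and>\<^sub>F e 7"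
  using hodge_monomial[of "[1, 2, 7]" "[3, 4, 5, 6]"]
    hodge_monomial[of "[3, 4, 7]" "[1, 2, 5, 6]"]
    hodge_monomial[of "[5, 6, 7]" "[1, 2, 3, 4]"]
    hodge_monomial[of "[1, 3, 5]" "[2, 4, 6, 7]"]
    hodge_monomial[of "[1, 4, 6]" "[2, 3, 5, 7]"]
    hodge_monomial[of "[2, 3, 6]" "[1, 4, 5, 7]"]
    hodge_monomial[of "[2, 4, 5]" "[1, 3, 6, 7]"]
    hodge_monomial[of "[1, 2, 5, 7]" "[3, 4, 6]"]
    hodge_monomial[of "[3, 4, 5, 7]" "[1, 2, 6]"]
    hodge_monomial[of "[1, 3, 5, 6]" "[2, 4, 7]"]
    hodge_monomial[of "[2, 4, 5, 6]" "[1, 3, 7]"]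
    hodge_monomial[of "[1, 4, 5, 6]" "[2, 3, 7]"]
    hodge_monomial[of "[2, 3, 5, 6]" "[1, 4, 7]"]
  by (simp_all add: interval7 monomial_Cons monomial_Nil minus_scale insert_commute)

lemma hodge_Theta:
  "hodge e E \<Theta> = (e 3 \<and>\<^sub>F e 4 \<and>\<^sub>F e 5 \<and>\<^sub>F e 6) + (e 1 \<and>\<^sub>F e 2 \<and>\<^sub>F e 5 \<and>\<^sub>F e 6) + (e 1 \<and>\<^sub>F e 2 \<and>\<^sub>F e 3 \<and>\<^sub>F e 4) - (e 2 \<and>\<^sub>F e 4 \<and>\<^sub>F e 6 \<and>\<^sub>F e 7) + (e 2 \<and>\<^sub>F e 3 \<and>\<^sub>F e 5 \<and>\<^sub>F e 7) + (e 1 \<and>\<^sub>F e 4 \<and>\<^sub>F e 5 \<and>\<^sub>F e 7) + (e 1 \<and>\<^sub>F e 3 \<and>\<^sub>F e 6 \<and>\<^sub>F e 7)"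
  unfolding Theta_eq by (simp add: hodge_linear hodge_table)

lemma ext_d_hodge_Theta: "ext_d (hodge e E \<Theta>) = 0"
  unfolding hodge_Theta
  by (rule form_eqI) (simp add: ext_d_normalize wedge_normalize scale_form_apply algebra_simps)

lemma ext_d_Theta_wedge_Theta: "ext_d \<Theta> \<and>\<^sub>F \<Theta> = 0"
  unfolding ext_d_Theta unfolding Theta_eq
  by (rule form_eqI) (simp add: wedge_normalize scale_form_apply algebra_simps)

lemma ext_d_wedge_hodge_Theta:
  "ext_d (e 6) \<and>\<^sub>F hodge e E \<Theta> = 0" "ext_d (e 7) \<and>\<^sub>F hodge e E \<Theta> = 0"
  unfolding ext_d_e hodge_Theta
  by (rule form_eqI, simp add: wedge_normalize scale_form_apply algebra_simps)+

lemma T_eq: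
  "T = (2 * t) *\<^sub>F ((e 3 \<and>\<^sub>F e 4 \<and>\<^sub>F e 6) - (e 1 \<and>\<^sub>F e 2 \<and>\<^sub>F e 6))
    + c1 *\<^sub>F ((e 1 \<and>\<^sub>F e 3 \<and>\<^sub>F e 7) + (e 2 \<and>\<^sub>F e 4 \<and>\<^sub>F e 7))
    + c2 *\<^sub>F ((e 1 \<and>\<^sub>F e 4 \<and>\<^sub>F e 7) - (e 2 \<and>\<^sub>F e 3 \<and>\<^sub>F e 7))"
  unfolding T ext_d_Theta
  by (rule form_eqI) (simp add: hodge_linear hodge_table scale_form_apply algebra_simps)

text \<open>The star of the 4-plane is -1 on the anti-self-dual forms de^6 and de^7, so the star of
  dTheta turns their companions e^{57} and e^{56} into e^6 and e^7. This puts the torsion into the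
  form that \<open>torsion_conn_form\<close> requires.\<close>

lemma T_eq_sum: "T = (\<Sum>m=1..7. e m \<and>\<^sub>F ext_d (e m))"
  unfolding T_eq sum7
  by (rule form_eqI) (simp add: ext_d_e wedge_normalize scale_form_apply algebra_simps)

text \<open>The derivative is the sum of the squares of de^6 and de^7, and the coefficients are
  minus their squared lengths 8t^2 and 2(c_1^2+c_2^2).\<close>

lemma ext_d_T:
  "ext_d T = (- (8 * t\<^sup>2 + 2 * (c1\<^sup>2 + c2\<^sup>2))) *\<^sub>F (e 1 \<and>\<^sub>F e 2 \<and>\<^sub>F e 3 \<and>\<^sub>F e 4)"
  unfolding T_eq
  by (rule form_eqI)
     (simp add: ext_d_normalize wedge_normalize scale_form_apply algebra_simps power2_eq_square)


section \<open>Connection and curvature of nabla^+\<close>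

lemma pair_E:
  assumes "a \<in> {1..7}" "b \<in> {1..7}" "j \<in> {1..7}" "i \<in> {1..7}"
  shows "(e a \<and>\<^sub>F e b) x [E j x, E i x] =
    (if a = j \<and> b = i then 1 else 0) - (if a = i \<and> b = j then 1 else 0)"
  unfolding wedge_degree1_pair[OF degree1_e[OF assms(1)]]
    e_E[OF assms(1,3)] e_E[OF assms(1,4)] e_E[OF assms(2,3)] e_E[OF assms(2,4)]
  by (cases "a = j"; cases "b = i"; cases "a = i"; cases "b = j")
     (simp_all only: if_True if_False mult_1 mult_zero_left mult_zero_right mult_1_right simp_thms)

text \<open>The value de^6(E_j, E_i), with the arguments in the order of the connection form; this
  reverses the sign of the coefficient of e^{ij}. The same holds for \<open>coeff7\<close>.\<close>

definition coeff6 :: "nat \<Rightarrow> nat \<Rightarrow> real" where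
  "coeff6 i j = (if i = 1 \<and> j = 2 then 2 * t else if i = 2 \<and> j = 1 then - 2 * t
    else if i = 3 \<and> j = 4 then - 2 * t else if i = 4 \<and> j = 3 then 2 * t else 0)"

definition coeff7 :: "nat \<Rightarrow> nat \<Rightarrow> real" where
  "coeff7 i j = (if i = 1 \<and> j = 3 \<or> i = 2 \<and> j = 4 then - c1
    else if i = 3 \<and> j = 1 \<or> i = 4 \<and> j = 2 then c1
    else if i = 1 \<and> j = 4 \<or> i = 3 \<and> j = 2 then - c2
    else if i = 4 \<and> j = 1 \<or> i = 2 \<and> j = 3 then c2 else 0)"

lemma ext_d_e_coeff:
  assumes "i \<in> {1..7}" "j \<in> {1..7}"
  shows "ext_d (e 6) x [E j x, E i x] = coeff6 i j" "ext_d (e 7) x [E j x, E i x] = coeff7 i j"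
  using assms unfolding interval7
  by (elim insertE emptyE; simp add: ext_d_e scale_form_apply pair_E coeff6_def coeff7_def)+

lemma conn_plus:
  assumes "levi_civita G \<Gamma> e nabla_g" "torsion_shift G \<Gamma> e nabla_g T nabla_plus"
    and "i \<in> {1..7}" "j \<in> {1..7}"
  shows "conn_form e E nabla_plus i j = coeff6 i j *\<^sub>F e 6 + coeff7 i j *\<^sub>F e 7"
  unfolding torsion_conn_form[OF assms(1,2) T_eq_sum assms(3,4)] sum7
  by (rule form_eqI)
     (simp add: ext_d_e(1-5) ext_d_e_coeff[OF assms(3,4)] scale_form_apply)

text \<open>The quadratic part is the commutator of the endomorphisms de^6 and de^7 times e^{67}. In
  su(2) it points in the third anti-self-dual direction, whence the multiples of 4t. Indices from 5
  on do not enter the connection.\<close>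

lemma curvature_plus:
  assumes "levi_civita G \<Gamma> e nabla_g" "torsion_shift G \<Gamma> e nabla_g T nabla_plus"
  defines "\<Omega> \<equiv> curvature e E nabla_plus"
  shows "\<Omega> 1 2 = (2 * t) *\<^sub>F ext_d (e 6)" "\<Omega> 3 4 = (- 2 * t) *\<^sub>F ext_d (e 6)"
    "\<Omega> 1 3 = (- c1) *\<^sub>F ext_d (e 7) + (4 * t * c2) *\<^sub>F (e 6 \<and>\<^sub>F e 7)"
    "\<Omega> 2 4 = (- c1) *\<^sub>F ext_d (e 7) + (4 * t * c2) *\<^sub>F (e 6 \<and>\<^sub>F e 7)"
    "\<Omega> 1 4 = (- c2) *\<^sub>F ext_d (e 7) - (4 * t * c1) *\<^sub>F (e 6 \<and>\<^sub>F e 7)"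
    "\<Omega> 2 3 = c2 *\<^sub>F ext_d (e 7) + (4 * t * c1) *\<^sub>F (e 6 \<and>\<^sub>F e 7)"
    "i \<in> {1..7} \<Longrightarrow> j \<in> {5..7} \<Longrightarrow> \<Omega> i j = 0"
proof -
  note conn = conn_plus[OF assms(1,2)]
  note [simp] = \<Omega>_def curvature_def sum7 conn coeff6_def coeff7_def ext_d_linear
    differentiable_form_intros differentiable_e
  show "\<Omega> 1 2 = (2 * t) *\<^sub>F ext_d (e 6)" "\<Omega> 3 4 = (- 2 * t) *\<^sub>F ext_d (e 6)"
    "\<Omega> 1 3 = (- c1) *\<^sub>F ext_d (e 7) + (4 * t * c2) *\<^sub>F (e 6 \<and>\<^sub>F e 7)"
    "\<Omega> 2 4 = (- c1) *\<^sub>F ext_d (e 7) + (4 * t * c2) *\<^sub>F (e 6 \<and>\<^sub>F e 7)"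
    "\<Omega> 1 4 = (- c2) *\<^sub>F ext_d (e 7) - (4 * t * c1) *\<^sub>F (e 6 \<and>\<^sub>F e 7)"
    "\<Omega> 2 3 = c2 *\<^sub>F ext_d (e 7) + (4 * t * c1) *\<^sub>F (e 6 \<and>\<^sub>F e 7)"
    by (rule form_eqI, simp add: wedge_normalize scale_form_apply algebra_simps)+
  show "\<Omega> i j = 0" if "i \<in> {1..7}" "j \<in> {5..7}"
    using that by simp
qed

text \<open>The e^{67} terms cancel in the sum because the commutator is orthogonal to de^7. What is
  left is 8t^2 times the square of de^6 and 2(c_1^2+c_2^2) times the square of de^7.\<close>

lemma p1_plus:
  assumes "levi_civita G \<Gamma> e nabla_g" "torsion_shift G \<Gamma> e nabla_g T nabla_plus"
  shows "p1 e E nabla_plus =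
    (- (64 * t ^ 4 + 4 * (c1\<^sup>2 + c2\<^sup>2)\<^sup>2) / (8 * pi\<^sup>2)) *\<^sub>F (e 1 \<and>\<^sub>F e 2 \<and>\<^sub>F e 3 \<and>\<^sub>F e 4)"
proof -
  note [simp] = curvature_plus[OF assms]
  have "(\<Sum>j=1..7. \<Sum>i=1..<j. curvature e E nabla_plus i j \<and>\<^sub>F curvature e E nabla_plus i j) =
      (- (64 * t ^ 4 + 4 * (c1\<^sup>2 + c2\<^sup>2)\<^sup>2)) *\<^sub>F (e 1 \<and>\<^sub>F e 2 \<and>\<^sub>F e 3 \<and>\<^sub>F e 4)"
    unfolding sum_pairs7
    by (rule form_eqI)
       (simp add: ext_d_e wedge_normalize scale_form_apply algebra_simps power2_eq_square power4_eq_xxxx)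
  then show ?thesis
    by (simp add: p1_def scale_scale)
qed

section \<open>Connection and curvature of A\<close>

definition coeffA :: "real \<Rightarrow> nat \<Rightarrow> nat \<Rightarrow> real" where
  "coeffA lam i j = (if i < j then lam else if j < i then - lam else 0)"

definition coeffA67 :: "nat \<Rightarrow> nat \<Rightarrow> real" where
  "coeffA67 i j = (if i = 6 \<and> j = 7 then 1 else if i = 7 \<and> j = 6 then - 1 else 0)"

definition rhoA :: "real \<Rightarrow> form" where
  "rhoA lam = e 1 + e 2 + e 3 + e 4 + e 5 + lam *\<^sub>F e 6 + lam *\<^sub>F e 7"

lemma rhoA_properties:
  "degree1 (rhoA lam)" "differentiable_form (rhoA lam)"
  "ext_d (rhoA lam) = lam *\<^sub>F (ext_d (e 6) + ext_d (e 7))"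
proof -
  show "degree1 (rhoA lam)"
    using degree1_e by (simp add: degree1_def rhoA_def scale_form_apply)
  show "differentiable_form (rhoA lam)" "ext_d (rhoA lam) = lam *\<^sub>F (ext_d (e 6) + ext_d (e 7))"
    by (simp_all add: rhoA_def differentiable_form_intros differentiable_e ext_d_linear ext_d_e(1-5)
        scale_add)
qed

text \<open>Metric compatibility extends the prescribed upper triangle: the lower one is its
  negative and the diagonal vanishes.\<close>

lemma conn_A:
  assumes metric: "metric_connection G \<Gamma> e nabla_A"
    and conn: "\<forall>i j. 1 \<le> i \<and> i < j \<and> j \<le> 7 \<longrightarrow> conn_form e E nabla_A i j =
      (if j \<le> 5 then lam *\<^sub>F e 7
       else if i = 6 \<and> j = 7 then e 1 + e 2 + e 3 + e 4 + e 5 + lam *\<^sub>F e 6 + lam *\<^sub>F e 7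
       else 0)"
    and "i \<in> {1..7}" "j \<in> {1..7}"
  shows "conn_form e E nabla_A i j =
    (if i \<le> 5 \<and> j \<le> 5 then coeffA lam i j *\<^sub>F e 7 else coeffA67 i j *\<^sub>F rhoA lam)"
proof -
  have upper: "conn_form e E nabla_A i j =
      (if i \<le> 5 \<and> j \<le> 5 then coeffA lam i j *\<^sub>F e 7 else coeffA67 i j *\<^sub>F rhoA lam)"
    if "i \<in> {1..7}" "j \<in> {1..7}" "i < j" for i j
    using that conn by (auto simp: coeffA_def coeffA67_def rhoA_def)
  have skew: "conn_form e E nabla_A i j = - conn_form e E nabla_A j i"
    using conn_form_skew[OF metric] assms(3,4) by blast
  consider "i < j" | "i = j" | "j < i" by linarith
  then show ?thesis
  proof cases
    case 1
    then show ?thesis using upper assms(3,4) by blast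
  next
    case 2
    then have "conn_form e E nabla_A i j = 0" using skew by (intro form_eq_neg) simp
    then show ?thesis using 2 by (auto simp: coeffA_def coeffA67_def)
  next
    case 3
    then show ?thesis
      unfolding skew using upper[of j i] assms(3,4)
      by (auto simp: coeffA_def coeffA67_def minus_scale)
  qed
qed

text \<open>The blocks on {1,...,5} and {6,7} do not interact, and each involves a single 1-form,
  whose wedge square is zero. Hence the quadratic terms vanish.\<close>

lemma curvature_A:
  assumes A: "metric_connection G \<Gamma> e nabla_A"
    "\<forall>i j. 1 \<le> i \<and> i < j \<and> j \<le> 7 \<longrightarrow> conn_form e E nabla_A i j =
      (if j \<le> 5 then lam *\<^sub>F e 7
       else if i = 6 \<and> j = 7 then e 1 + e 2 + e 3 + e 4 + e 5 + lam *\<^sub>F e 6 + lam *\<^sub>F e 7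
       else 0)"
    and ij: "i \<in> {1..7}" "j \<in> {1..7}"
  shows "curvature e E nabla_A i j =
    (if i \<le> 5 \<and> j \<le> 5 then coeffA lam i j *\<^sub>F ext_d (e 7)
     else (coeffA67 i j * lam) *\<^sub>F (ext_d (e 6) + ext_d (e 7)))"
proof -
  note conn = conn_A[OF A]
  have "conn_form e E nabla_A i k \<and>\<^sub>F conn_form e E nabla_A k j = 0" if "k \<in> {1..7}" for k
    using ij that
    by (simp add: conn wedge_linear e_self wedge_self_last rhoA_properties)
       (simp add: coeffA67_def)
  then have "curvature e E nabla_A i j = ext_d (conn_form e E nabla_A i j)"
    by (simp add: curvature_def)
  then show ?thesis
    using ij by (simp add: conn ext_d_linear differentiable_e rhoA_properties scale_scale)
qed

text \<open>Ten pairs below 6 contribute the square of de^7 and the pair (6,7) the square of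
  de^6+de^7, in which the mixed term vanishes. So de^7 is counted eleven times, giving 22 = 11 * 2,
  and de^6 once, giving 8.\<close>

lemma p1_A:
  assumes A: "metric_connection G \<Gamma> e nabla_A"
    "\<forall>i j. 1 \<le> i \<and> i < j \<and> j \<le> 7 \<longrightarrow> conn_form e E nabla_A i j =
      (if j \<le> 5 then lam *\<^sub>F e 7
       else if i = 6 \<and> j = 7 then e 1 + e 2 + e 3 + e 4 + e 5 + lam *\<^sub>F e 6 + lam *\<^sub>F e 7
       else 0)"
  shows "p1 e E nabla_A =
    (- lam\<^sup>2 * (8 * t\<^sup>2 + 22 * (c1\<^sup>2 + c2\<^sup>2)) / (8 * pi\<^sup>2)) *\<^sub>F (e 1 \<and>\<^sub>F e 2 \<and>\<^sub>F e 3 \<and>\<^sub>F e 4)"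
proof -
  note [simp] = curvature_A[OF A] coeffA_def coeffA67_def
  have "(\<Sum>j=1..7. \<Sum>i=1..<j. curvature e E nabla_A i j \<and>\<^sub>F curvature e E nabla_A i j) =
      (- lam\<^sup>2 * (8 * t\<^sup>2 + 22 * (c1\<^sup>2 + c2\<^sup>2))) *\<^sub>F (e 1 \<and>\<^sub>F e 2 \<and>\<^sub>F e 3 \<and>\<^sub>F e 4)"
    unfolding sum_pairs7
    by (rule form_eqI)
       (simp add: ext_d_e wedge_normalize scale_form_apply algebra_simps power2_eq_square)
  then show ?thesis
    by (simp add: p1_def scale_scale)
qed

end

subsection \<open>The parallel spinor\<close>

locale clifford =
  fixes cl :: "nat \<Rightarrow> spinor \<Rightarrow> spinor"
  assumes module: "clifford_module cl"
begin

lemma cl_linear: "i \<in> {1..7} \<Longrightarrow> linear (cl i)"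
  using module by (simp add: clifford_module_def)

lemma cl_simps:
  assumes "i \<in> {1..7}"
  shows "cl i 0 = 0" "cl i (- \<psi>) = - cl i \<psi>" "cl i (\<psi> + \<eta>) = cl i \<psi> + cl i \<eta>"
    "cl i (\<psi> - \<eta>) = cl i \<psi> - cl i \<eta>" "cl i (c *\<^sub>R \<psi>) = c *\<^sub>R cl i \<psi>"
  using cl_linear[OF assms]
  by (simp_all add: linear_0 linear_neg linear_add linear_diff linear_cmul)

lemma cl_square: "i \<in> {1..7} \<Longrightarrow> cl i (cl i \<psi>) = - \<psi>"
proof -
  assume "i \<in> {1..7}"
  then have "cl i (cl i \<psi>) + cl i (cl i \<psi>) = (- 2) *\<^sub>R \<psi>"
    using module by (simp add: clifford_module_def)
  then have "2 *\<^sub>R cl i (cl i \<psi>) = 2 *\<^sub>R (- \<psi>)" by (simp add: scaleR_2)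
  then show ?thesis by (simp only: scaleR_cancel_left) simp
qed

lemma cl_swap: "i < j \<Longrightarrow> i \<in> {1..7} \<Longrightarrow> j \<in> {1..7} \<Longrightarrow> cl j (cl i \<psi>) = - cl i (cl j \<psi>)"
  using module by (auto simp: clifford_module_def eq_neg_iff_add_eq_0)

lemma cl_inner_self: "i \<in> {1..7} \<Longrightarrow> cl i \<psi> \<bullet> \<psi> = 0"
proof -
  assume "i \<in> {1..7}"
  then have "cl i \<psi> \<bullet> \<psi> = - (\<psi> \<bullet> cl i \<psi>)"
    using module by (auto simp: clifford_module_def)
  then show ?thesis by (simp add: inner_commute)
qed

lemma cl_nonzero: "i \<in> {1..7} \<Longrightarrow> \<psi> \<noteq> 0 \<Longrightarrow> cl i \<psi> \<noteq> 0"
  using cl_square[of i \<psi>] cl_simps(1)[of i] by auto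

lemmas cl_normalize = cl_simps cl_square cl_swap

text \<open>$E_1E_2E_7$, $E_3E_4E_7$ and $E_1E_3E_5$ are commuting involutions; $E_3$, $E_1$ and $E_7$ in turn
  flip the sign of one of them while preserving those of the preceding ones.\<close>

lemma joint_eigenspinor:
  obtains \<eta> where "\<eta> \<noteq> 0" "cl 1 (cl 2 (cl 7 \<eta>)) = - \<eta>" "cl 3 (cl 4 (cl 7 \<eta>)) = - \<eta>"
    "cl 1 (cl 3 (cl 5 \<eta>)) = - \<eta>"
proof -
  obtain \<psi> :: spinor where \<psi>: "\<psi> \<noteq> 0" using zero_neq_one by blast
  have "\<exists>\<psi>\<noteq>0. cl 1 (cl 2 (cl 7 \<psi>)) = - \<psi>"
  proof (cases "cl 1 (cl 2 (cl 7 \<psi>)) = \<psi>")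
    case True
    have "cl 1 (cl 2 (cl 7 (cl 3 \<psi>))) = - cl 3 (cl 1 (cl 2 (cl 7 \<psi>)))"
      by (simp add: cl_normalize)
    then show ?thesis using True \<psi> by (intro exI[of _ "cl 3 \<psi>"]) (simp add: cl_nonzero)
  next
    case False
    \<comment> \<open>Subtracting the image under the involution projects, up to a factor 2, to the
      -1 eigenspace; the result is nonzero because the spinor is not fixed.\<close>
    then show ?thesis
      by (intro exI[of _ "\<psi> - cl 1 (cl 2 (cl 7 \<psi>))"]) (simp add: cl_normalize)
  qed
  then obtain \<psi> where \<psi>: "\<psi> \<noteq> 0" "cl 1 (cl 2 (cl 7 \<psi>)) = - \<psi>" by blast
  have "\<exists>\<psi>\<noteq>0. cl 1 (cl 2 (cl 7 \<psi>)) = - \<psi> \<and> cl 3 (cl 4 (cl 7 \<psi>)) = - \<psi>"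
  proof (cases "cl 3 (cl 4 (cl 7 \<psi>)) = \<psi>")
    case True
    have "cl 1 (cl 2 (cl 7 (cl 1 \<psi>))) = cl 1 (cl 1 (cl 2 (cl 7 \<psi>)))"
      "cl 3 (cl 4 (cl 7 (cl 1 \<psi>))) = - cl 1 (cl 3 (cl 4 (cl 7 \<psi>)))"
      by (simp_all add: cl_normalize)
    then show ?thesis
      using True \<psi> by (intro exI[of _ "cl 1 \<psi>"]) (simp add: cl_nonzero cl_simps)
  next
    case False
    have "cl 1 (cl 2 (cl 7 (cl 3 (cl 4 (cl 7 \<psi>))))) = cl 3 (cl 4 (cl 7 (cl 1 (cl 2 (cl 7 \<psi>)))))"
      by (simp add: cl_normalize)
    moreover have "cl 3 (cl 4 (cl 7 (cl 3 (cl 4 (cl 7 \<psi>))))) = \<psi>"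
      by (simp add: cl_normalize)
    ultimately show ?thesis
      using False \<psi> by (intro exI[of _ "\<psi> - cl 3 (cl 4 (cl 7 \<psi>))"]) (simp add: cl_simps)
  qed
  then obtain \<psi> where \<psi>: "\<psi> \<noteq> 0" "cl 1 (cl 2 (cl 7 \<psi>)) = - \<psi>" "cl 3 (cl 4 (cl 7 \<psi>)) = - \<psi>"
    by blast
  show thesis
  proof (cases "cl 1 (cl 3 (cl 5 \<psi>)) = \<psi>")
    case True
    have "cl 1 (cl 2 (cl 7 (cl 7 \<psi>))) = cl 7 (cl 1 (cl 2 (cl 7 \<psi>)))"
      "cl 3 (cl 4 (cl 7 (cl 7 \<psi>))) = cl 7 (cl 3 (cl 4 (cl 7 \<psi>)))"
      "cl 1 (cl 3 (cl 5 (cl 7 \<psi>))) = - cl 7 (cl 1 (cl 3 (cl 5 \<psi>)))"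
      by (simp_all add: cl_normalize)
    then show thesis
      using True \<psi> by (intro that[of "cl 7 \<psi>"]) (simp_all only: cl_nonzero, simp_all add: cl_simps cl_nonzero)
  next
    case False
    have "cl 1 (cl 2 (cl 7 (cl 1 (cl 3 (cl 5 \<psi>))))) = cl 1 (cl 3 (cl 5 (cl 1 (cl 2 (cl 7 \<psi>)))))"
      "cl 3 (cl 4 (cl 7 (cl 1 (cl 3 (cl 5 \<psi>))))) = cl 1 (cl 3 (cl 5 (cl 3 (cl 4 (cl 7 \<psi>)))))"
      "cl 1 (cl 3 (cl 5 (cl 1 (cl 3 (cl 5 \<psi>))))) = \<psi>"
      by (simp_all add: cl_normalize)
    then show thesis
      using False \<psi> by (intro that[of "\<psi> - cl 1 (cl 3 (cl 5 \<psi>))"]) (simp_all add: cl_simps)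
  qed
qed

text \<open>The eigenvalue equations and the volume relation, solved for the last four generators:
  any Clifford word on \<open>\<eta>\<close> reduces up to sign to one of the eight words in E_1,
  E_2, E_3.\<close>

definition G2_spinor :: "spinor \<Rightarrow> bool" where
  "G2_spinor \<eta> \<longleftrightarrow> \<eta> \<noteq> 0 \<and> cl 4 \<eta> = - cl 1 (cl 2 (cl 3 \<eta>)) \<and> cl 5 \<eta> = cl 1 (cl 3 \<eta>) \<and>
     cl 6 \<eta> = - cl 2 (cl 3 \<eta>) \<and> cl 7 \<eta> = cl 1 (cl 2 \<eta>)"

lemma G2_spinor_exists: "\<exists>\<eta>. G2_spinor \<eta>"
proof -
  obtain \<eta> where \<eta>: "\<eta> \<noteq> 0" "cl 1 (cl 2 (cl 7 \<eta>)) = - \<eta>" "cl 3 (cl 4 (cl 7 \<eta>)) = - \<eta>"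
    "cl 1 (cl 3 (cl 5 \<eta>)) = - \<eta>"
    by (rule joint_eigenspinor)
  have volume: "cl 1 (cl 2 (cl 3 (cl 4 (cl 5 (cl 6 (cl 7 \<eta>)))))) = \<eta>"
  proof -
    have "[1..<8] = [1, 2, 3, 4, 5, 6, 7::nat]" by (simp add: upt_conv_Cons)
    then have "foldr cl [1, 2, 3, 4, 5, 6, 7] \<eta> = \<eta>"
      using module by (simp add: clifford_module_def)
    then show ?thesis by simp
  qed
  have cl7: "cl 7 \<eta> = cl 1 (cl 2 \<eta>)"
    using arg_cong[OF \<eta>(2), of "\<lambda>\<psi>. cl 2 (cl 1 \<psi>)"] by (simp add: cl_normalize)
  have cl5: "cl 5 \<eta> = cl 1 (cl 3 \<eta>)"
    using arg_cong[OF \<eta>(4), of "\<lambda>\<psi>. cl 3 (cl 1 \<psi>)"] by (simp add: cl_normalize)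
  have cl4: "cl 4 \<eta> = - cl 1 (cl 2 (cl 3 \<eta>))"
    using arg_cong[OF \<eta>(3), of "\<lambda>\<psi>. cl 7 (cl 3 \<psi>)"] by (simp add: cl_normalize cl7) (metis minus_minus)
  \<comment> \<open>E_6 occurs in none of the three involutions. Its action comes from the volume
    element, which is where the choice between the two Clifford modules enters.\<close>
  have cl6: "cl 6 \<eta> = - cl 2 (cl 3 \<eta>)"
    using arg_cong[OF volume, of "\<lambda>\<psi>. cl 5 (cl 4 (cl 3 (cl 2 (cl 1 (cl 7 \<psi>)))))"]
    by (simp add: cl_normalize cl7 cl4 cl5)
  show ?thesis
    using \<eta>(1) cl4 cl5 cl6 cl7 by (auto simp: G2_spinor_def)
qed

lemma G2_spinor_simps:
  assumes "G2_spinor \<eta>"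
  shows "cl 4 \<eta> = - cl 1 (cl 2 (cl 3 \<eta>))" "cl 5 \<eta> = cl 1 (cl 3 \<eta>)"
    "cl 6 \<eta> = - cl 2 (cl 3 \<eta>)" "cl 7 \<eta> = cl 1 (cl 2 \<eta>)"
  using assms by (auto simp: G2_spinor_def)

text \<open>Up to sign each of the seven words is some E_i on \<open>\<eta>\<close>, and every E_i
  is skew.\<close>

lemma G2_spinor_orthogonal:
  assumes "G2_spinor \<eta>"
  shows "cl 1 \<eta> \<bullet> \<eta> = 0" "cl 2 \<eta> \<bullet> \<eta> = 0" "cl 3 \<eta> \<bullet> \<eta> = 0" "cl 1 (cl 2 \<eta>) \<bullet> \<eta> = 0"
    "cl 1 (cl 3 \<eta>) \<bullet> \<eta> = 0" "cl 2 (cl 3 \<eta>) \<bullet> \<eta> = 0" "cl 1 (cl 2 (cl 3 \<eta>)) \<bullet> \<eta> = 0"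
  using cl_inner_self[of _ \<eta>] cl_inner_self[of 4 \<eta>] cl_inner_self[of 5 \<eta>]
    cl_inner_self[of 6 \<eta>] cl_inner_self[of 7 \<eta>]
  by (simp_all add: G2_spinor_simps[OF assms])

end

locale nil_coframe_spinor = nil_coframe + clifford
begin

lemma clifford_action_pair:
  "a < b \<Longrightarrow> {a, b} \<subseteq> {1..7} \<Longrightarrow> clifford_action E cl (e a \<and>\<^sub>F e b) \<epsilon> x = cl a (cl b (\<epsilon> x))"
  using clifford_action_monomial[of "[a, b]"] by (simp add: monomial_Cons monomial_Nil)

lemma clifford_action_triple:
  "a < b \<Longrightarrow> b < c \<Longrightarrow> {a, b, c} \<subseteq> {1..7} \<Longrightarrow>
    clifford_action E cl (e a \<and>\<^sub>F e b \<and>\<^sub>F e c) \<epsilon> x = cl a (cl b (cl c (\<epsilon> x)))"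
  using clifford_action_monomial[of "[a, b, c]"] by (simp add: monomial_Cons monomial_Nil)

context
  fixes \<eta> assumes \<eta>: "G2_spinor \<eta>"
begin

text \<open>Behind the computation: \<open>T\<close> is the sum of e^m wedge de^m for m = 6, 7, and
  E_6, E_7 commute with Clifford products of two of E_1,...,E_4, so the vanishing comes down to de^6
  and de^7 killing \<open>\<eta>\<close>.\<close>

lemma T_annihilates: "clifford_action E cl T (\<lambda>_. \<eta>) x = 0"
  unfolding T_eq
  by (simp add: clifford_action_linear clifford_action_triple cl_normalize G2_spinor_simps[OF \<eta>])

lemma ext_d_annihilates:
  "clifford_action E cl (ext_d (e 6)) (\<lambda>_. \<eta>) x = 0"
  "clifford_action E cl (ext_d (e 7)) (\<lambda>_. \<eta>) x = 0"
  unfolding ext_d_e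
  by (simp_all add: clifford_action_linear clifford_action_pair cl_normalize G2_spinor_simps[OF \<eta>])

text \<open>For a constant spinor only the algebraic term is left, and it is half the Clifford
  action of e^6(v) de^6 + e^7(v) de^7.\<close>

lemma parallel:
  assumes "levi_civita G \<Gamma> e nabla_g" "torsion_shift G \<Gamma> e nabla_g T nabla_plus"
  shows "spin_connection e E cl nabla_plus (\<lambda>_. \<eta>) x v = 0"
proof -
  note [simp] = conn_plus[OF assms] coeff6_def coeff7_def
  have "(\<Sum>k=1..7. \<Sum>j=1..<k. conn_form e E nabla_plus k j x [v] *\<^sub>R cl j (cl k \<eta>)) = 0"
    unfolding sum_pairs7
    by (simp add: scale_form_apply cl_normalize G2_spinor_simps[OF \<eta>])
  then show ?thesis by (simp add: spin_connection_def)
qed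

text \<open>A check of all 343 index triples: each word reduces to a multiple of
  \<open>\<eta>\<close>, which reproduces a term of Theta, or up to sign to one of the words
  orthogonal to \<open>\<eta>\<close>.\<close>

lemma defines_Theta: "spinor_defines E cl (\<lambda>_. \<eta>) \<Theta>"
  unfolding spinor_defines_def Theta_eq
proof (intro allI ballI)
  fix x i j k assume "i \<in> {1..7::nat}" "j \<in> {1..7::nat}" "k \<in> {1..7::nat}"
  then show "\<eta> \<bullet> \<eta> * ((e 1 \<and>\<^sub>F e 2 \<and>\<^sub>F e 7) + (e 3 \<and>\<^sub>F e 4 \<and>\<^sub>F e 7) + (e 5 \<and>\<^sub>F e 6 \<and>\<^sub>F e 7) + (e 1 \<and>\<^sub>F e 3 \<and>\<^sub>F e 5)
    - (e 1 \<and>\<^sub>F e 4 \<and>\<^sub>F e 6) - (e 2 \<and>\<^sub>F e 3 \<and>\<^sub>F e 6) - (e 2 \<and>\<^sub>F e 4 \<and>\<^sub>F e 5)) x [E i x, E j x, E k x] =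
      - (cl i (cl j (cl k \<eta>)) \<bullet> \<eta>)"
    unfolding interval7
    by (elim insertE emptyE; simp add: wedge_degree1_triple wedge_degree1_pair degree1_e e_E
        cl_normalize G2_spinor_simps[OF \<eta>] G2_spinor_orthogonal[OF \<eta>])
qed

end

end

subsection \<open>The heterotic system\<close>

theorem theorem5p3:
  fixes t c1 c2 lam \<phi> :: real
    and G :: "R7 monoid" and \<Gamma> :: "R7 set"
    and e :: "nat \<Rightarrow> form" and E :: "nat \<Rightarrow> R7 \<Rightarrow> R7"
    and \<Theta> T :: form
    and nabla_g nabla_plus nabla_A :: connection
    and cl :: "nat \<Rightarrow> spinor \<Rightarrow> spinor"
  assumes "t \<noteq> 0" and "c1 \<in> \<rat>" and "c2 \<in> \<rat>" and "(c1, c2) \<noteq> (0, 0)"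
    and "lie_group G" and "simply_connected (carrier G)" and "nilpotent G"
    and "left_invariant_basis G e"
    and "\<forall>i\<in>{1..5}. ext_d (e i) = 0"
    and "ext_d (e 6) = (- 2 * t) *\<^sub>F (monomial e [1,2] - monomial e [3,4])"
    and "ext_d (e 7) = c1 *\<^sub>F (monomial e [1,3] + monomial e [2,4]) + c2 *\<^sub>F (monomial e [1,4] - monomial e [2,3])"
    and "lattice_of_max_rank G \<Gamma>"
    and "dual_frame e E"
    and "\<Theta> = (monomial e [1,2] + monomial e [3,4] + monomial e [5,6]) \<and>\<^sub>F e 7
             + monomial e [1,3,5] - monomial e [1,4,6] - monomial e [2,3,6] - monomial e [2,4,5]"
    and "T = - hodge e E (ext_d \<Theta>)"
    and "levi_civita G \<Gamma> e nabla_g"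
    and "torsion_shift G \<Gamma> e nabla_g T nabla_plus"
    and "metric_connection G \<Gamma> e nabla_A"
    and "\<forall>i j. 1 \<le> i \<and> i < j \<and> j \<le> 7 \<longrightarrow>
           conn_form e E nabla_A i j =
             (if j \<le> 5 then lam *\<^sub>F e 7
              else if i = 6 \<and> j = 7 then e 1 + e 2 + e 3 + e 4 + e 5 + lam *\<^sub>F e 6 + lam *\<^sub>F e 7
              else 0)"
    and "clifford_module cl"
    and "lam\<^sup>2 < min (8 * t\<^sup>2) (2 * (c1\<^sup>2 + c2\<^sup>2) / 11)"
  shows "\<exists>\<alpha>'. \<alpha>' > 0 \<and>
           ext_d T = (2 * pi\<^sup>2 * \<alpha>') *\<^sub>F (p1 e E nabla_plus - p1 e E nabla_A) \<and>
           compact_heterotic_solution G \<Gamma> e E cl \<Theta> nabla_plus nabla_A \<phi> T \<alpha>'"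
proof -
  note basis = \<open>left_invariant_basis G e\<close> and lattice = \<open>lattice_of_max_rank G \<Gamma>\<close>
    and lc = \<open>levi_civita G \<Gamma> e nabla_g\<close> and shift = \<open>torsion_shift G \<Gamma> e nabla_g T nabla_plus\<close>
    and A = \<open>metric_connection G \<Gamma> e nabla_A\<close>
      \<open>\<forall>i j. 1 \<le> i \<and> i < j \<and> j \<le> 7 \<longrightarrow>
           conn_form e E nabla_A i j =
             (if j \<le> 5 then lam *\<^sub>F e 7
              else if i = 6 \<and> j = 7 then e 1 + e 2 + e 3 + e 4 + e 5 + lam *\<^sub>F e 6 + lam *\<^sub>F e 7
              else 0)\<close>
  interpret nil_coframe_spinor e E G \<Gamma> t c1 c2 \<Theta> T cl
  proof unfold_locales
    show "one_form (e i)" "invariant_form G (carrier G) (e i)" if "i \<in> {1..7}" for i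
      using basis that by (auto simp: left_invariant_basis_def left_invariant_one_form_def)
    show "\<Gamma> \<subseteq> carrier G"
      using lattice by (simp add: lattice_of_max_rank_def subgroup.subset)
  qed fact+
  define C where "C = c1\<^sup>2 + c2\<^sup>2"
  \<comment> \<open>The difference of the two Pontryagin forms is -N/(8 pi^2) times e^{1234}; this
    grouping makes each bound on lam^2 control one summand.\<close>
  define N where "N = 8 * t\<^sup>2 * (8 * t\<^sup>2 - lam\<^sup>2) + 2 * C * (2 * C - 11 * lam\<^sup>2)"
  \<comment> \<open>Forced by comparing coefficients: 2 pi^2 \<alpha>' N/(8 pi^2) = \<alpha>' N/4
    must equal 8t^2 + 2C.\<close>
  define \<alpha>' where "\<alpha>' = 4 * (8 * t\<^sup>2 + 2 * C) / N"
  have C: "C > 0"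
    using \<open>(c1, c2) \<noteq> (0, 0)\<close> by (auto simp: C_def sum_power2_gt_zero_iff)
  have "lam\<^sup>2 < 8 * t\<^sup>2" "11 * lam\<^sup>2 < 2 * C"
    using \<open>lam\<^sup>2 < min (8 * t\<^sup>2) (2 * (c1\<^sup>2 + c2\<^sup>2) / 11)\<close> by (auto simp: C_def)
  then have N: "N > 0"
    using C \<open>t \<noteq> 0\<close> unfolding N_def by (intro add_pos_pos mult_pos_pos) auto
  have \<alpha>': "\<alpha>' > 0"
    using N C by (simp add: \<alpha>'_def add_nonneg_pos)
  have anomaly: "ext_d T = (2 * pi\<^sup>2 * \<alpha>') *\<^sub>F (p1 e E nabla_plus - p1 e E nabla_A)"
  proof -
    have P: "- (64 * t ^ 4 + 4 * C\<^sup>2) / (8 * pi\<^sup>2) - - lam\<^sup>2 * (8 * t\<^sup>2 + 22 * C) / (8 * pi\<^sup>2)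
        = - N / (8 * pi\<^sup>2)"
      by (simp add: N_def diff_divide_distrib[symmetric] algebra_simps power2_eq_square power4_eq_xxxx)
    have "- (8 * t\<^sup>2 + 2 * C) = 2 * pi\<^sup>2 * \<alpha>' * (- N / (8 * pi\<^sup>2))"
      using N by (simp add: \<alpha>'_def field_simps)
    then show ?thesis
      unfolding ext_d_T p1_plus[OF lc shift] p1_A[OF A] C_def[symmetric]
      by (intro form_eqI) (simp only: scale_form_apply minus_apply left_diff_distrib[symmetric]
          mult.assoc[symmetric] P fun_diff_def)
  qed
  obtain \<eta> where \<eta>: "G2_spinor \<eta>"
    using G2_spinor_exists by blast
  have "heterotic_killing_spinor_eqs G \<Gamma> e E cl \<Theta> nabla_plus nabla_A (\<lambda>_. \<phi>) T"
    unfolding heterotic_killing_spinor_eqs_def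
  proof (rule bexI[of _ "\<lambda>_. \<eta>"], intro conjI allI ballI)
    show "(\<lambda>_. \<eta>) \<in> spinor_fields_on G \<Gamma>"
      by (simp add: spinor_fields_on_def smooth_const)
    show "\<eta> \<noteq> 0" using \<eta> by (simp add: G2_spinor_def)
    show "spinor_defines E cl (\<lambda>_. \<eta>) \<Theta>" by (rule defines_Theta[OF \<eta>])
    show "spin_connection e E cl nabla_plus (\<lambda>_. \<eta>) x v = 0" for x v
      by (rule parallel[OF \<eta> lc shift])
    show "clifford_action E cl (ext_d (fun_form (\<lambda>_. \<phi>)) - (1/2) *\<^sub>F T) (\<lambda>_. \<eta>) x = 0" for x
      by (simp add: clifford_action_linear T_annihilates[OF \<eta>])
    show "clifford_action E cl (curvature e E nabla_A i j) (\<lambda>_. \<eta>) x = 0"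
      if "i \<in> {1..7}" "j \<in> {1..7}" for i j x
      unfolding curvature_A[OF A that]
      by (simp add: clifford_action_linear ext_d_annihilates[OF \<eta>])
  qed
  moreover have "G2_instanton e E \<Theta> nabla_A"
    by (simp add: G2_instanton_def curvature_A[OF A] wedge_linear ext_d_wedge_hodge_Theta)
  moreover have "cocalibrated_pure_type e E \<Theta>"
    by (simp add: cocalibrated_pure_type_def ext_d_hodge_Theta ext_d_Theta_wedge_Theta)
  ultimately have "compact_heterotic_solution G \<Gamma> e E cl \<Theta> nabla_plus nabla_A \<phi> T \<alpha>'"
    using lattice \<open>T = - hodge e E (ext_d \<Theta>)\<close> anomaly \<alpha>'
    by (simp add: compact_heterotic_solution_def anomaly_cancellation_def lattice_of_max_rank_def)
  with anomaly \<alpha>' show ?thesis by blast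
qed

end
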